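(* Let $n\ge2$. For any $c\in W_{C_n^{(1)}}^0=\mathcal C_{2n}^s$, we have $$L_{C_n^{(1)}}(c)=L(c),$$ that is, $L_{C_n^{(1)}}(c)$ is equal to the number of boxes in the self-conjugate $2n$-core $c$.
   Context: A $2n$-core is a partition having no hook length equal to $2n$; $\mathcal C_{2n}$ is the set of $2n$-cores and $\mathcal C_{2n}^s$ the subset of self-conjugate ones. The box in row $i$, column $j$ has residue $(j-i)\bmod 2n$; boxes of residue $i$ are $i$-nodes. The affine Weyl group $\widetilde{\mathfrak S}_{2n}$ of type $A_{2n-1}^{(1)}$, with simple reflections $s_0,\dots,s_{2n-1}$, acts on $\mathcal C_{2n}$: $s_i\cdot c$ is obtained by removing all removable $i$-nodes of $c$ if there are some, adding all addable $i$-nodes if there are some, and $s_i\cdot c=c$ otherwise. $L(c)$ denotes the number of boxes of $c$. Let $\alpha_0,\dots,\alpha_{2n-1}$ and $\Lambda_0,\dots,\Lambda_{2n-1}$ be the simple roots and fundamental weights of the affine root system of type $A_{2n-1}^{(1)}$, on which $\widetilde{\mathfrak S}_{2n}$ acts by $s_i(x)=x-\langle x,\alpha_i^\vee\rangle\alpha_i$. The affine root system of type $C_n^{(1)}$ is realized by $\alpha_0^{C_n^{(1)}}=2\alpha_0$, $\alpha_i^{C_n^{(1)}}=\alpha_i+\alpha_{2n-i}$ ($1\le i\le n-1$), $\alpha_n^{C_n^{(1)}}=2\alpha_n$, $\Lambda_0^{C_n^{(1)}}=2\Lambda_0$, and its Weyl group $W_{C_n^{(1)}}$ as the subgroup of $\widetilde{\mathfrak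 S}_{2n}$ generated by $s_0$, $s_is_{2n-i}$ ($1\le i\le n-1$), $s_n$. The affine Grassmannian $W_{C_n^{(1)}}^0$ (minimal length representatives of left cosets modulo the finite Weyl group generated by all these generators except $s_0$) is identified with $\mathcal C_{2n}^s$ via $w\mapsto w\cdot\varnothing$. The atomic length: for $w\in W_{C_n^{(1)}}^0$ with $c=w\cdot\varnothing$, write $\Lambda_0^{C_n^{(1)}}-w(\Lambda_0^{C_n^{(1)}})=\sum_{i=0}^n a_i^{C_n^{(1)}}(c)\,\alpha_i^{C_n^{(1)}}$; then $L_{C_n^{(1)}}(c)=\sum_{i=0}^n a_i^{C_n^{(1)}}(c)$ (the number of simple roots of type $C_n^{(1)}$ in the decomposition). *)

theory Defs
  imports Complex_Main "HOL-Algebra.Generated_Groups" "HOL-Algebra.Bij"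
begin

section \<open>Partitions, cores and residues\<close>

text \<open>
  A partition \<open>\<lambda>\<close> is identified with its Young diagram \<open>{(i, j). j < \<lambda>\<^sub>i}\<close>, where \<open>i\<close> is the row
  and \<open>j\<close> the column. Rows and columns are numbered from 0; the residue only depends on \<open>j - i\<close>,
  so it agrees with the one for numbering from 1.
\<close>

type_synonym box = "nat \<times> nat"

definition is_partition :: "box set \<Rightarrow> bool" where
  "is_partition c \<longleftrightarrow>
     finite c \<and> (\<forall>i j i' j'. (i, j) \<in> c \<longrightarrow> i' \<le> i \<longrightarrow> j' \<le> j \<longrightarrow> (i', j') \<in> c)"

definition conjugate :: "box set \<Rightarrow> box set" where
  "conjugate c = {(i, j). (j, i) \<in> c}"

definition hook :: "box set \<Rightarrow> box \<Rightarrow> box set" where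
  "hook c b = {(i, j) \<in> c. (i = fst b \<and> snd b \<le> j) \<or> (j = snd b \<and> fst b \<le> i)}"

definition hook_length :: "box set \<Rightarrow> box \<Rightarrow> nat" where
  "hook_length c b = card (hook c b)"

definition cores :: "nat \<Rightarrow> box set set" where
  "cores N = {c. is_partition c \<and> (\<forall>b\<in>c. hook_length c b \<noteq> N)}"

definition self_conjugate_cores :: "nat \<Rightarrow> box set set" where
  "self_conjugate_cores N = {c \<in> cores N. conjugate c = c}"

definition num_boxes :: "box set \<Rightarrow> nat" where
  "num_boxes c = card c"

definition residue :: "nat \<Rightarrow> box \<Rightarrow> nat" where
  "residue N b = nat ((int (snd b) - int (fst b)) mod int N)"

definition removable_nodes :: "nat \<Rightarrow> nat \<Rightarrow> box set \<Rightarrow> box set" where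
  "removable_nodes N i c = {b \<in> c. residue N b = i \<and> is_partition (c - {b})}"

definition addable_nodes :: "nat \<Rightarrow> nat \<Rightarrow> box set \<Rightarrow> box set" where
  "addable_nodes N i c = {b. b \<notin> c \<and> residue N b = i \<and> is_partition (insert b c)}"

definition core_reflection :: "nat \<Rightarrow> nat \<Rightarrow> box set \<Rightarrow> box set" where
  "core_reflection N i c =
     (if removable_nodes N i c \<noteq> {} then c - removable_nodes N i c
      else c \<union> addable_nodes N i c)"


section \<open>The affine Weyl group of type \<open>A\<^bsub>2n-1\<^esub>\<close>\<close>

text \<open>
  Weights are given by coordinates in the basis \<open>\<Lambda>\<^sub>0, \<dots>, \<Lambda>\<^bsub>2n-1\<^esub>, \<delta>\<close>: the value at \<open>Some i\<close> is the
  coefficient of \<open>\<Lambda>\<^sub>i\<close> and the value at \<open>None\<close> that of the null root \<open>\<delta>\<close>. The latter is needed for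
  the simple roots to be linearly independent. Coordinates at \<open>Some i\<close> with \<open>i \<ge> 2n\<close> play no role:
  they vanish on all roots and weights below, and the reflections leave them unchanged.
\<close>

type_synonym weight = "nat option \<Rightarrow> real"

definition fundamental_weight :: "nat \<Rightarrow> weight" where
  "fundamental_weight i = (\<lambda>k. if k = Some i then 1 else 0)"

text \<open>The Cartan matrix of the cycle with \<open>2n\<close> vertices, where \<open>2n \<ge> 4\<close>.\<close>

definition cartan_A :: "nat \<Rightarrow> nat \<Rightarrow> nat \<Rightarrow> real" where
  "cartan_A n i j =
     (if i = j then 2 else if j = (i + 1) mod (2 * n) \<or> i = (j + 1) mod (2 * n) then - 1 else 0)"

text \<open>\<open>\<alpha>\<^sub>i = (\<Sum>j<2n. \<langle>\<alpha>\<^sub>i, \<alpha>\<^sub>j\<^sup>\<or>\<rangle> \<Lambda>\<^sub>j)\<close> for \<open>i \<noteq> 0\<close>, with an additional summand \<open>\<delta>\<close> for \<open>i = 0\<close>.\<close>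

definition simple_root_A :: "nat \<Rightarrow> nat \<Rightarrow> weight" where
  "simple_root_A n i = (\<lambda>k. case k of
       Some j \<Rightarrow> if j < 2 * n then cartan_A n j i else 0
     | None \<Rightarrow> if i = 0 then 1 else 0)"

text \<open>\<open>\<langle>\<Lambda>\<^sub>j, \<alpha>\<^sub>i\<^sup>\<or>\<rangle>\<close> is 1 for \<open>i = j\<close> and 0 otherwise, and \<open>\<langle>\<delta>, \<alpha>\<^sub>i\<^sup>\<or>\<rangle> = 0\<close>.\<close>

definition coroot_pairing :: "weight \<Rightarrow> nat \<Rightarrow> real" where
  "coroot_pairing x i = x (Some i)"

definition reflection_A :: "nat \<Rightarrow> nat \<Rightarrow> weight \<Rightarrow> weight" where
  "reflection_A n i x = (\<lambda>k. x k - coroot_pairing x i * simple_root_A n i k)"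

definition weyl_A :: "nat \<Rightarrow> (weight \<Rightarrow> weight) set" where
  "weyl_A n = generate (BijGroup UNIV) (reflection_A n ` {..<2 * n})"

definition word_prod :: "(nat \<Rightarrow> weight \<Rightarrow> weight) \<Rightarrow> nat list \<Rightarrow> weight \<Rightarrow> weight" where
  "word_prod s is = foldr (\<lambda>i w. s i \<circ> w) is id"

text \<open>
  The action of \<open>w \<in> weyl_A n\<close> on a \<open>2n\<close>-core, determined by the action of the simple reflections:
  \<open>w\<close> is written as a word in them; the result does not depend on the word.
\<close>

definition core_action :: "nat \<Rightarrow> (weight \<Rightarrow> weight) \<Rightarrow> box set \<Rightarrow> box set" where
  "core_action n w c =
     (THE d. \<exists>is. set is \<subseteq> {..<2 * n} \<and> word_prod (reflection_A n) is = w \<and>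
                  foldr (core_reflection (2 * n)) is c = d)"


section \<open>Type \<open>C\<^sub>n\<close> and the atomic length\<close>

definition simple_root_C :: "nat \<Rightarrow> nat \<Rightarrow> weight" where
  "simple_root_C n i =
     (if i = 0 \<or> i = n then (\<lambda>k. 2 * simple_root_A n i k)
      else (\<lambda>k. simple_root_A n i k + simple_root_A n (2 * n - i) k))"

definition Lambda0_C :: weight where
  "Lambda0_C = (\<lambda>k. 2 * fundamental_weight 0 k)"

definition generator_C :: "nat \<Rightarrow> nat \<Rightarrow> weight \<Rightarrow> weight" where
  "generator_C n i =
     (if i = 0 \<or> i = n then reflection_A n i
      else reflection_A n i \<circ> reflection_A n (2 * n - i))"

definition weyl_C :: "nat \<Rightarrow> (weight \<Rightarrow> weight) set" where
  "weyl_C n = generate (BijGroup UNIV) (generator_C n ` {..n})"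

lemma reflection_A_Bij:
  assumes "i < 2 * n"
  shows "reflection_A n i \<in> Bij UNIV"
proof -
  have "reflection_A n i (reflection_A n i x) = x" for x
    using assms by (auto simp: reflection_A_def coroot_pairing_def simple_root_A_def cartan_A_def)
  then show ?thesis
    by (metis (no_types, lifting) Bij_def IntI UNIV_I bij_betw_def bij_def extensional_UNIV
        involuntory_imp_bij mem_Collect_eq)
qed

lemma weyl_C_subset_weyl_A:
  assumes "n \<ge> 2"
  shows "weyl_C n \<subseteq> weyl_A n"
proof -
  interpret G: group "BijGroup (UNIV :: weight set)" by (rule group_BijGroup)
  have sub: "reflection_A n ` {..<2 * n} \<subseteq> carrier (BijGroup UNIV)"
    by (auto simp: BijGroup_def reflection_A_Bij)
  have "generator_C n i \<in> weyl_A n" if "i \<le> n" for i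
  proof (cases "i = 0 \<or> i = n")
    case True
    then show ?thesis
      using assms by (auto simp: generator_C_def weyl_A_def intro: generate.incl)
  next
    case False
    then have i: "i < 2 * n" "2 * n - i < 2 * n" using that by auto
    then have "reflection_A n i \<otimes>\<^bsub>BijGroup UNIV\<^esub> reflection_A n (2 * n - i) \<in> weyl_A n"
      unfolding weyl_A_def by (intro generate.eng generate.incl) auto
    moreover have "reflection_A n i \<otimes>\<^bsub>BijGroup UNIV\<^esub> reflection_A n (2 * n - i)
        = reflection_A n i \<circ> reflection_A n (2 * n - i)"
      using i by (auto simp: BijGroup_def reflection_A_Bij compose_def)
    ultimately show ?thesis using False by (simp add: generator_C_def)
  qed
  then show ?thesis
    unfolding weyl_C_def weyl_A_def
    by (intro G.generate_subgroup_incl G.generate_is_subgroup sub) (auto simp: weyl_A_def)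
qed

definition finite_weyl_C :: "nat \<Rightarrow> (weight \<Rightarrow> weight) set" where
  "finite_weyl_C n = generate (BijGroup UNIV) (generator_C n ` {1..n})"

definition length_C :: "nat \<Rightarrow> (weight \<Rightarrow> weight) \<Rightarrow> nat" where
  "length_C n w =
     (LEAST l. \<exists>is. length is = l \<and> set is \<subseteq> {..n} \<and> word_prod (generator_C n) is = w)"

definition grassmannian_C :: "nat \<Rightarrow> (weight \<Rightarrow> weight) set" where
  "grassmannian_C n =
     {w \<in> weyl_C n. \<forall>u\<in>finite_weyl_C n. length_C n w \<le> length_C n (w \<circ> u)}"

text \<open>
  The coefficients \<open>a\<^sub>0, \<dots>, a\<^sub>n\<close> in \<open>\<Lambda>\<^sub>0 - w \<Lambda>\<^sub>0 = (\<Sum>i\<le>n. a\<^sub>i \<alpha>\<^sub>i)\<close> (type \<open>C\<close>), where \<open>w\<close> is the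
  Grassmannian element identified with \<open>c\<close>. The coefficients beyond \<open>n\<close> are set to 0 to make the
  function unique.
\<close>

definition coeff_C :: "nat \<Rightarrow> box set \<Rightarrow> nat \<Rightarrow> real" where
  "coeff_C n c =
     (THE a. (\<forall>i>n. a i = 0) \<and>
        (\<exists>w\<in>grassmannian_C n. core_action n w {} = c \<and>
           (\<forall>k. Lambda0_C k - w Lambda0_C k = (\<Sum>i\<le>n. a i * simple_root_C n i k))))"

definition atomic_length_C :: "nat \<Rightarrow> box set \<Rightarrow> real" where
  "atomic_length_C n c = (\<Sum>i\<le>n. coeff_C n c i)"

end

theory Submission
  imports Defs
begin

text \<open>
  Attach to a core \<open>c\<close> the weight \<open>\<Lambda>\<^sub>0 - (\<Sum>b\<in>c. \<alpha>\<^bsub>res b\<^esub>)\<close> of type A, one simple root for each box. The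
  reflections of cores correspond to the reflections of these weights
  (\<open>core_weight_core_reflection\<close>), so that \<open>\<Lambda>\<^sub>0 - w \<Lambda>\<^sub>0\<close> is the sum of the simple roots
  \<open>\<alpha>\<^bsub>res b\<^esub>\<close> over the boxes of \<open>w \<cdot> \<emptyset>\<close>. The fundamental weight of type C is twice \<open>\<Lambda>\<^sub>0\<close>, hence
  every box counts twice. For a self-conjugate core, one of the two copies can be moved to the
  transposed box, whose residue is the opposite one; and \<open>\<alpha>\<^sub>r + \<alpha>\<^bsub>2n-r\<^esub>\<close>, or \<open>2 \<alpha>\<^sub>r\<close> if
  \<open>r\<close> is 0 or \<open>n\<close>, is a simple root of type C. Each box therefore contributes exactly one simple
  root of type C (\<open>sum_simple_root_C_self_conjugate\<close>), and as these roots are linearly independent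
  (\<open>simple_root_C_independent\<close>), the sum of the coefficients is the number of boxes.
  
  The weight identity comes from a linear description of the reflections. Let \<open>h k\<close> be the row in
  which the diagonal of content \<open>k\<close> leaves the diagram. Then \<open>h\<close> decreases by 0 or 1 at each step;
  the steps at which it decreases are the beads of the usual abacus, and \<open>c\<close> is an \<open>N\<close>-core if and
  only if shifting a bead by \<open>-N\<close> gives a bead (\<open>cores_iff_core_profile\<close>). On a core, the
  reflection with index \<open>r\<close> replaces \<open>h k\<close> by \<open>h (k - 1) + h (k + 1) - h k\<close> at all contents
  \<open>k\<close> that are congruent to \<open>r\<close> (\<open>core_reflection_eq_diagram_swap\<close>). This is visibly an
  involution, and the number of boxes of residue \<open>r\<close> changes by the sum of the second differences
  of \<open>h\<close>, which is the value of the coroot on the weight of \<open>c\<close>.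
  
  Two further points make the definitions meaningful. The action on cores does not depend on the
  word, because a nonempty core contains the box \<open>(0, 0)\<close> of residue 0, so that the coefficient of
  \<open>\<delta>\<close> already distinguishes its weight from \<open>\<Lambda>\<^sub>0\<close> (\<open>foldr_core_reflection_cong\<close>). And every
  self-conjugate core arises from a Grassmannian element: a removable node and its transpose allow
  a generator of type C to shrink the core (\<open>exists_decreasing_generator\<close>), so the core is
  \<open>w \<cdot> \<emptyset>\<close> for some \<open>w\<close> in the Weyl group of type C, and passing to an element of minimal length
  in the coset of \<open>w\<close> keeps the core because the finite Weyl group fixes \<open>\<Lambda>\<^sub>0\<close>.
\<close>

section \<open>Partitions and their diagonal profiles\<close>

definition content :: "box \<Rightarrow> int" where
  "content b = int (snd b) - int (fst b)"

definition diagonal :: "box set \<Rightarrow> int \<Rightarrow> box set" where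
  "diagonal c k = {b \<in> c. content b = k}"

text \<open>
  For a partition, the boxes of content \<open>k\<close> fill the diagonal without gaps from its first row
  \<open>max 0 (- k)\<close> on, so this is the first row whose box of content \<open>k\<close> lies outside the diagram.
\<close>

definition height :: "box set \<Rightarrow> int \<Rightarrow> int" where
  "height c k = max 0 (- k) + int (card (diagonal c k))"

definition diagram :: "(int \<Rightarrow> int) \<Rightarrow> box set" where
  "diagram h = {b. int (fst b) < h (content b)}"

text \<open>
  Read from right to left, such a function is the boundary path of a Young diagram: it stays
  constant on a horizontal step and increases on a vertical one, and agrees with the path of the
  empty diagram far out in both directions.
\<close>

definition profile :: "(int \<Rightarrow> int) \<Rightarrow> bool" where
  "profile h \<longleftrightarrow>
     (\<forall>k. h (k - 1) = h k \<or> h (k - 1) = h k + 1) \<and> finite {k. h k \<noteq> max 0 (- k)}"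

lemma residue_content: "residue N b = nat (content b mod int N)"
  by (simp add: residue_def content_def)

lemma residue_less: "N > 0 \<Longrightarrow> residue N b < N"
  by (simp add: residue_content nat_less_iff)

lemma residue_eq_iff: "N > 0 \<Longrightarrow> residue N b = r \<longleftrightarrow> content b mod int N = int r"
  by (auto simp: residue_content)

lemma finite_down_closed_nat:
  fixes T :: "nat set"
  assumes "finite T" and "\<And>s t. t \<in> T \<Longrightarrow> s \<le> t \<Longrightarrow> s \<in> T"
  obtains l where "\<And>t. t \<in> T \<longleftrightarrow> t < l"
proof -
  have ex: "\<exists>t. t \<notin> T" using assms(1) ex_new_if_finite infinite_UNIV_nat by blast
  define l where "l = (LEAST t. t \<notin> T)"
  have "l \<notin> T" unfolding l_def using ex by (rule LeastI_ex)
  moreover have "t \<in> T" if "t < l" for t using that not_less_Least unfolding l_def by blast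
  ultimately have "t \<in> T \<longleftrightarrow> t < l" for t using assms(2) not_le by blast
  then show thesis using that by blast
qed

lemma is_partition_finite: "is_partition c \<Longrightarrow> finite c"
  by (simp add: is_partition_def)

lemma is_partitionD: "is_partition c \<Longrightarrow> (i, j) \<in> c \<Longrightarrow> i' \<le> i \<Longrightarrow> j' \<le> j \<Longrightarrow> (i', j') \<in> c"
  unfolding is_partition_def by blast

lemma mem_iff_less_height:
  assumes "is_partition c"
  shows "b \<in> c \<longleftrightarrow> int (fst b) < height c (content b)"
proof -
  define k where "k = content b"
  \<comment> \<open>The box in position \<open>t\<close> on the diagonal of content \<open>k\<close>.\<close>
  define e where "e t = (nat (- k) + t, nat k + t)" for t
  have inj: "inj e" by (auto simp: inj_def e_def)
  define T where "T = {t. e t \<in> c}"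
  have img: "diagonal c k = e ` T"
  proof (rule Set.set_eqI)
    fix x :: box
    obtain i j where x: "x = (i, j)" by (cases x)
    show "x \<in> diagonal c k \<longleftrightarrow> x \<in> e ` T"
    proof
      assume a: "x \<in> diagonal c k"
      then have "x = e (min i j)" by (auto simp: diagonal_def e_def x content_def)
      with a show "x \<in> e ` T" by (auto simp: diagonal_def T_def)
    qed (auto simp: T_def diagonal_def e_def content_def)
  qed
  have "finite (diagonal c k)" using is_partition_finite[OF assms] by (simp add: diagonal_def)
  then have fin: "finite T" using inj img by (metis finite_image_iff inj_on_subset subset_UNIV)
  have down: "s \<in> T" if "t \<in> T" "s \<le> t" for s t
    using that is_partitionD[OF assms] unfolding T_def e_def by simp
  obtain l where l: "\<And>t. t \<in> T \<longleftrightarrow> t < l" using finite_down_closed_nat[of T] fin down by metis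
  then have "T = {..<l}" by auto
  then have h: "height c k = max 0 (- k) + int l"
    by (simp add: height_def img card_image inj_on_subset[OF inj])
  have b: "e (min (fst b) (snd b)) = b" by (cases b) (auto simp: e_def k_def content_def)
  have "b \<in> c \<longleftrightarrow> min (fst b) (snd b) < l"
    using l[of "min (fst b) (snd b)"] unfolding T_def mem_Collect_eq b .
  also have "\<dots> \<longleftrightarrow> int (fst b) < height c k"
    unfolding h by (auto simp: k_def content_def)
  finally show ?thesis by (simp add: k_def)
qed

lemma diagram_height: "is_partition c \<Longrightarrow> diagram (height c) = c"
  using mem_iff_less_height by (auto simp: diagram_def)

lemma height_lower: "max 0 (- k) \<le> height c k"
  by (simp add: height_def)

lemma profile_height:
  assumes "is_partition c"
  shows "profile (height c)"
  unfolding profile_def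
proof (intro conjI allI)
  note mem = mem_iff_less_height[OF assms]
  fix k :: int
  have "height c k \<le> height c (k - 1)"
  proof (rule ccontr)
    assume neg: "\<not> ?thesis"
    define i where "i = nat (height c k - 1)"
    have i: "int i = height c k - 1" "int i + k \<ge> 1"
      using neg height_lower[of "k - 1" c] height_lower[of k c] unfolding i_def by linarith+
    then have "(i, nat (int i + k)) \<in> c" by (subst mem) (auto simp: content_def)
    then have "(i, nat (int i + k - 1)) \<in> c"
      using is_partitionD[OF assms, of i "nat (int i + k)" i "nat (int i + k - 1)"]
      by (simp add: nat_mono)
    then show False using i neg by (subst (asm) mem) (auto simp: content_def)
  qed
  moreover have "height c (k - 1) \<le> height c k + 1"
  proof (rule ccontr)
    assume neg: "\<not> ?thesis"
    define i where "i = nat (height c (k - 1) - 1)"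
    have i: "int i = height c (k - 1) - 1" "int i \<ge> 1" "int i + k - 1 \<ge> 0"
      using neg height_lower[of "k - 1" c] height_lower[of k c] unfolding i_def by linarith+
    then have "(i, nat (int i + k - 1)) \<in> c" by (subst mem) (auto simp: content_def)
    then have "(i - 1, nat (int i + k - 1)) \<in> c"
      using is_partitionD[OF assms, of i "nat (int i + k - 1)" "i - 1"] by simp
    then show False using i neg by (subst (asm) mem) (auto simp: content_def of_nat_diff)
  qed
  ultimately show "height c (k - 1) = height c k \<or> height c (k - 1) = height c k + 1" by linarith
next
  have "k \<in> content ` c" if "height c k \<noteq> max 0 (- k)" for k
  proof -
    from that have "diagonal c k \<noteq> {}" by (auto simp: height_def)
    then show ?thesis by (auto simp: diagonal_def)
  qed
  then have "{k. height c k \<noteq> max 0 (- k)} \<subseteq> content ` c" by blast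
  then show "finite {k. height c k \<noteq> max 0 (- k)}"
    using finite_subset is_partition_finite[OF assms] by blast
qed

lemma profile_step: "profile h \<Longrightarrow> h (k - 1) = h k \<or> h (k - 1) = h k + 1"
  by (simp add: profile_def)

lemma profile_mono:
  assumes "profile h" and "k \<le> l"
  shows "h l \<le> h k" and "h k + k \<le> h l + l"
proof -
  have "h l \<le> h k \<and> h k + k \<le> h l + l" using assms(2)
  proof (induction l rule: int_ge_induct)
    case base
    then show ?case by simp
  next
    case (step l)
    then show ?case using profile_step[OF assms(1), of "l + 1"] by auto
  qed
  then show "h l \<le> h k" and "h k + k \<le> h l + l" by auto
qed

text \<open>
  Both \<open>h k\<close> and \<open>h k + k\<close> are monotone, and they vanish far to the right and far to the left.
\<close>

lemma profile_lower:
  assumes "profile h"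
  shows "max 0 (- k) \<le> h k"
proof -
  let ?F = "{k. h k \<noteq> max 0 (- k)}"
  have fin: "finite ?F" using assms by (simp add: profile_def)
  have "\<not> {k..} \<subseteq> ?F" using fin infinite_Ici finite_subset by blast
  then obtain r where r: "r \<ge> k" "h r = max 0 (- r)" by auto
  have "\<not> {..k} \<subseteq> ?F" using fin infinite_Iic finite_subset by blast
  then obtain l where l: "l \<le> k" "h l = max 0 (- l)" by auto
  show ?thesis using profile_mono[OF assms r(1)] profile_mono[OF assms l(1)] r l by linarith
qed

lemma is_partition_diagram:
  assumes "profile h"
  shows "is_partition (diagram h)"
  unfolding is_partition_def
proof (intro conjI allI impI)
  let ?F = "{k. h k \<noteq> max 0 (- k)}"
  let ?S = "SIGMA k:?F. {..<nat (h k)}"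
  have "diagram h \<subseteq> (\<lambda>(k, i). (i, nat (int i + k))) ` ?S"
  proof
    fix b assume "b \<in> diagram h"
    then have S: "(content b, fst b) \<in> ?S" by (auto simp: diagram_def content_def)
    have "b = (\<lambda>(k, i). (i, nat (int i + k))) (content b, fst b)"
      by (cases b) (simp add: content_def)
    then show "b \<in> (\<lambda>(k, i). (i, nat (int i + k))) ` ?S" using S by (rule image_eqI)
  qed
  moreover have "finite ?S" using assms by (intro finite_SigmaI) (auto simp: profile_def)
  ultimately show "finite (diagram h)" by (meson finite_imageI finite_subset)
next
  fix i j i' j' :: nat
  assume "(i, j) \<in> diagram h" "i' \<le> i" "j' \<le> j"
  then show "(i', j') \<in> diagram h"
    using profile_mono[OF assms, of "int j' - int i'" "int j - int i'"]
      profile_mono[OF assms, of "int j - int i" "int j - int i'"]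
    by (auto simp: diagram_def content_def)
qed

lemma height_diagram:
  assumes "profile h"
  shows "height (diagram h) = h"
proof
  fix k
  let ?I = "{nat (max 0 (- k))..<nat (h k)}"
  have "diagonal (diagram h) k = (\<lambda>i. (i, nat (int i + k))) ` ?I"
  proof (rule Set.set_eqI)
    fix b :: box
    obtain i j where b: "b = (i, j)" by (cases b)
    show "b \<in> diagonal (diagram h) k \<longleftrightarrow> b \<in> (\<lambda>i. (i, nat (int i + k))) ` ?I"
      by (auto simp: b diagonal_def diagram_def content_def image_iff)
  qed
  moreover have "inj_on (\<lambda>i. (i, nat (int i + k))) ?I" by (auto simp: inj_on_def)
  ultimately have "card (diagonal (diagram h) k) = card ?I" by (simp add: card_image)
  then show "height (diagram h) k = h k"
    using profile_lower[OF assms, of k] unfolding height_def by (simp add: of_nat_diff nat_mono)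
qed

lemma height_insert:
  assumes "finite c" and "b \<notin> c"
  shows "height (insert b c) = (height c)(content b := height c (content b) + 1)"
proof
  fix k
  have "diagonal (insert b c) k = (if k = content b then insert b (diagonal c k) else diagonal c k)"
    by (auto simp: diagonal_def)
  then show "height (insert b c) k = ((height c)(content b := height c (content b) + 1)) k"
    using assms by (simp add: height_def diagonal_def)
qed

text \<open>
  Adding a box of content \<open>k\<close> raises the height at \<open>k\<close> alone. The result is again a boundary path
  exactly when the step into \<open>k\<close> can turn from a drop into a flat one and the step out of \<open>k\<close> from a
  flat one into a drop.
\<close>

lemma addable_iff:
  assumes "is_partition c"
  shows "b \<notin> c \<and> is_partition (insert b c) \<longleftrightarrow>
     int (fst b) = height c (content b) \<and>
     height c (content b - 1) = height c (content b) + 1 \<and>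
     height c (content b + 1) = height c (content b)"
    (is "?L \<longleftrightarrow> ?R")
proof
  let ?k = "content b" and ?h = "height c"
  note fin = is_partition_finite[OF assms]
  note prof = profile_height[OF assms]
  show ?R if ?L
  proof -
    from that have hi: "height (insert b c) = ?h(?k := ?h ?k + 1)"
      using height_insert fin by blast
    have p: "profile (?h(?k := ?h ?k + 1))"
      using profile_height[of "insert b c"] that hi by simp
    have "int (fst b) < ?h ?k + 1" "\<not> int (fst b) < ?h ?k"
      using mem_iff_less_height[of "insert b c" b] mem_iff_less_height[OF assms, of b] that hi by auto
    then show ?R
      using profile_step[OF p, of ?k] profile_step[OF p, of "?k + 1"]
        profile_step[OF prof, of ?k] profile_step[OF prof, of "?k + 1"] by auto
  qed
  show ?L if ?R
  proof -
    let ?g = "?h(?k := ?h ?k + 1)"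
    have "profile ?g"
      unfolding profile_def
    proof (intro conjI allI)
      fix k
      show "?g (k - 1) = ?g k \<or> ?g (k - 1) = ?g k + 1"
        using that profile_step[OF prof, of k] by (auto simp: algebra_simps)
      have "{k. ?g k \<noteq> max 0 (- k)} \<subseteq> insert ?k {k. ?h k \<noteq> max 0 (- k)}" by auto
      then show "finite {k. ?g k \<noteq> max 0 (- k)}"
        using prof unfolding profile_def by (meson finite_insert finite_subset)
    qed
    then have "is_partition (diagram ?g)" by (rule is_partition_diagram)
    moreover have "diagram ?g = insert b c"
    proof (rule Set.set_eqI)
      fix x :: box
      have "x = b \<longleftrightarrow> content x = ?k \<and> int (fst x) = ?h ?k"
        using that by (cases x; cases b) (auto simp: content_def)
      then show "x \<in> diagram ?g \<longleftrightarrow> x \<in> insert b c"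
        using mem_iff_less_height[OF assms, of x] by (auto simp: diagram_def)
    qed
    ultimately show ?L using mem_iff_less_height[OF assms, of b] that by simp
  qed
qed

lemma removable_iff:
  assumes "is_partition c"
  shows "b \<in> c \<and> is_partition (c - {b}) \<longleftrightarrow>
     int (fst b) = height c (content b) - 1 \<and>
     height c (content b - 1) = height c (content b) \<and>
     height c (content b + 1) = height c (content b) - 1"
    (is "?L \<longleftrightarrow> ?R")
proof
  let ?k = "content b" and ?h = "height c"
  note prof = profile_height[OF assms]
  show ?R if ?L
  proof -
    let ?c = "c - {b}"
    have "insert b ?c = c" using that by auto
    then have "height c = (height ?c)(?k := height ?c ?k + 1)"
      using height_insert[of ?c b] is_partition_finite[OF assms] by auto
    then show ?R using addable_iff[of ?c b] that \<open>insert b ?c = c\<close> assms by auto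
  qed
  show ?L if ?R
  proof -
    let ?g = "?h(?k := ?h ?k - 1)"
    have "profile ?g"
      unfolding profile_def
    proof (intro conjI allI)
      fix k
      show "?g (k - 1) = ?g k \<or> ?g (k - 1) = ?g k + 1"
        using that profile_step[OF prof, of k] by (auto simp: algebra_simps)
      have "{k. ?g k \<noteq> max 0 (- k)} \<subseteq> insert ?k {k. ?h k \<noteq> max 0 (- k)}" by auto
      then show "finite {k. ?g k \<noteq> max 0 (- k)}"
        using prof unfolding profile_def by (meson finite_insert finite_subset)
    qed
    then have "is_partition (diagram ?g)" by (rule is_partition_diagram)
    moreover have "diagram ?g = c - {b}"
    proof (rule Set.set_eqI)
      fix x :: box
      have "x = b \<longleftrightarrow> content x = ?k \<and> int (fst x) = ?h ?k - 1"
        using that by (cases x; cases b) (auto simp: content_def)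
      then show "x \<in> diagram ?g \<longleftrightarrow> x \<in> c - {b}"
        using mem_iff_less_height[OF assms, of x] by (auto simp: diagram_def)
    qed
    ultimately show ?L using mem_iff_less_height[OF assms, of b] that by simp
  qed
qed


section \<open>Beads and hooks\<close>

definition bead :: "(int \<Rightarrow> int) \<Rightarrow> int \<Rightarrow> bool" where
  "bead h k \<longleftrightarrow> h (k - 1) = h k + 1"

lemma row_length:
  assumes "is_partition c"
  obtains l where "\<And>j. (i, j) \<in> c \<longleftrightarrow> j < l"
proof -
  have "{j. (i, j) \<in> c} \<subseteq> snd ` c" by force
  then have "finite {j. (i, j) \<in> c}"
    using is_partition_finite[OF assms] finite_subset by blast
  then obtain l where "\<And>j. j \<in> {j. (i, j) \<in> c} \<longleftrightarrow> j < l"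
    by (rule finite_down_closed_nat) (use is_partitionD[OF assms, of i] in auto)
  then show thesis using that by simp
qed

lemma column_length:
  assumes "is_partition c"
  obtains m where "\<And>i. (i, j) \<in> c \<longleftrightarrow> i < m"
proof -
  have "{i. (i, j) \<in> c} \<subseteq> fst ` c" by force
  then have "finite {i. (i, j) \<in> c}"
    using is_partition_finite[OF assms] finite_subset by blast
  then obtain m where "\<And>i. i \<in> {i. (i, j) \<in> c} \<longleftrightarrow> i < m"
    by (rule finite_down_closed_nat) (use is_partitionD[OF assms, of _ j _ j] in auto)
  then show thesis using that by simp
qed

text \<open>
  The hook length is written as a difference of two numbers of which the first belongs to the row
  and the second to the column: the position of the bead at the end of the row, and the position
  of the gap at the end of the column.
\<close>

lemma hook_length_arm_leg:
  assumes row: "\<And>j'. (i, j') \<in> c \<longleftrightarrow> j' < l" and col: "\<And>i'. (i', j) \<in> c \<longleftrightarrow> i' < m"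
    and "(i, j) \<in> c"
  shows "int (hook_length c (i, j)) = (int l - int i) - (int j + 1 - int m)"
proof -
  have less: "j < l" "i < m" using assms by blast+
  have "hook c (i, j) = Pair i ` {j..<l} \<union> (\<lambda>i'. (i', j)) ` {Suc i..<m}" (is "_ = ?A \<union> ?B")
  proof (rule Set.set_eqI)
    fix b :: box
    obtain i' j' where b: "b = (i', j')" by (cases b)
    have "b \<in> hook c (i, j) \<longleftrightarrow> i' = i \<and> j \<le> j' \<and> j' < l \<or> j' = j \<and> i \<le> i' \<and> i' < m"
      unfolding b hook_def using row[of j'] col[of i'] by auto
    then show "b \<in> hook c (i, j) \<longleftrightarrow> b \<in> ?A \<union> ?B" using less by (auto simp: b image_iff)
  qed
  moreover have "card (?A \<union> ?B) = card ?A + card ?B" by (rule card_Un_disjoint) auto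
  moreover have "card ?A = l - j" "card ?B = m - Suc i" by (simp_all add: card_image inj_on_def)
  ultimately show ?thesis using less by (simp add: hook_length_def)
qed

lemma bead_row_end:
  assumes "is_partition c" and row: "\<And>j. (i, j) \<in> c \<longleftrightarrow> j < l"
  shows "bead (height c) (int l - int i)"
proof -
  let ?k = "int l - int i"
  have "height c ?k \<le> int i"
    using row[of l] mem_iff_less_height[OF assms(1), of "(i, l)"] by (simp add: content_def)
  moreover have "int i < height c (?k - 1)"
  proof (cases l)
    case 0
    then show ?thesis using height_lower[of "?k - 1" c] by simp
  next
    case (Suc l')
    then show ?thesis
      using row[of l'] mem_iff_less_height[OF assms(1), of "(i, l')"]
      by (simp add: content_def algebra_simps)
  qed
  ultimately show ?thesis
    using profile_step[OF profile_height[OF assms(1)], of ?k] by (auto simp: bead_def)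
qed

lemma no_bead_column_end:
  assumes "is_partition c" and col: "\<And>i. (i, j) \<in> c \<longleftrightarrow> i < m"
  shows "\<not> bead (height c) (int j + 1 - int m)"
proof -
  let ?k = "int j + 1 - int m"
  have "height c (?k - 1) \<le> int m"
    using col[of m] mem_iff_less_height[OF assms(1), of "(m, j)"] by (simp add: content_def)
  moreover have "int m \<le> height c ?k"
  proof (cases m)
    case 0
    then show ?thesis using height_lower[of ?k c] by simp
  next
    case (Suc m')
    then show ?thesis
      using col[of m'] mem_iff_less_height[OF assms(1), of "(m', j)"]
      by (simp add: content_def algebra_simps)
  qed
  ultimately show ?thesis by (auto simp: bead_def)
qed

text \<open>
  The bead at \<open>k\<close> ends the row \<open>h k\<close>, which has length \<open>k + h k\<close>, and the gap at \<open>l\<close> ends the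
  column \<open>h l + l - 1\<close>, which has length \<open>h l\<close>. The bead lies to the right of the gap exactly when
  this row and this column meet inside the diagram.
\<close>

lemma bead_gap_hook:
  assumes "is_partition c" and k: "bead (height c) k" and l: "\<not> bead (height c) l" and "l < k"
  obtains b where "b \<in> c" and "int (hook_length c b) = k - l"
proof -
  let ?h = "height c"
  note prof = profile_height[OF assms(1)]
  note mem = mem_iff_less_height[OF assms(1)]
  note mono = profile_mono[OF prof]
  have hk: "?h (k - 1) = ?h k + 1" using k by (simp add: bead_def)
  have hl: "?h (l - 1) = ?h l" using l profile_step[OF prof, of l] by (auto simp: bead_def)
  define i where "i = nat (?h k)"
  define L where "L = nat (k + ?h k)"
  define j where "j = nat (?h l + l - 1)"
  define m where "m = nat (?h l)"
  have ints: "int i = ?h k" "int L = k + ?h k" "int j = ?h l + l - 1" "int m = ?h l"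
    using height_lower[of k c] height_lower[of l c] height_lower[of "l - 1" c] hl
    by (auto simp: i_def L_def j_def m_def)
  have row: "(i, j') \<in> c \<longleftrightarrow> j' < L" for j'
    using mono(1)[of "int j' - int i" "k - 1"] mono(1)[of k "int j' - int i"] ints(1,2) hk
    unfolding mem content_def fst_conv snd_conv by linarith
  have col: "(i', j) \<in> c \<longleftrightarrow> i' < m" for i'
    using mono(2)[of l "int j - int i'"] mono(2)[of "int j - int i'" "l - 1"] ints(3,4) hl
    unfolding mem content_def fst_conv snd_conv by linarith
  have "j < L" using mono(2)[of l k] \<open>l < k\<close> ints by linarith
  then have b: "(i, j) \<in> c" by (simp add: row)
  moreover have "int (hook_length c (i, j)) = k - l"
    using hook_length_arm_leg[OF row col b] ints by simp
  ultimately show thesis using that by blast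
qed

definition core_profile :: "nat \<Rightarrow> (int \<Rightarrow> int) \<Rightarrow> bool" where
  "core_profile N h \<longleftrightarrow> profile h \<and> (\<forall>k. bead h k \<longrightarrow> bead h (k - int N))"

text \<open>
  A hook of length \<open>N\<close> is a bead with a gap \<open>N\<close> positions to its left.
\<close>

lemma cores_iff_core_profile:
  assumes "N > 0"
  shows "c \<in> cores N \<longleftrightarrow> is_partition c \<and> core_profile N (height c)"
proof (intro iffI conjI)
  assume c: "c \<in> cores N"
  then show part: "is_partition c" by (simp add: cores_def)
  show "core_profile N (height c)"
    unfolding core_profile_def
  proof (intro conjI allI impI)
    show "profile (height c)" using part by (rule profile_height)
    fix k assume k: "bead (height c) k"
    show "bead (height c) (k - int N)"
    proof (rule ccontr)
      assume "\<not> bead (height c) (k - int N)"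
      then obtain b where "b \<in> c" "int (hook_length c b) = k - (k - int N)"
        by (rule bead_gap_hook[OF part k]) (use assms in auto)
      then show False using c by (auto simp: cores_def)
    qed
  qed
next
  assume c: "is_partition c \<and> core_profile N (height c)"
  have "hook_length c b \<noteq> N" if b: "b \<in> c" for b
  proof
    assume N: "hook_length c b = N"
    obtain i j where ij: "b = (i, j)" by (cases b)
    obtain l where row: "\<And>j. (i, j) \<in> c \<longleftrightarrow> j < l" using row_length c by blast
    obtain m where col: "\<And>i. (i, j) \<in> c \<longleftrightarrow> i < m" using column_length c by blast
    have "int l - int i - int N = int j + 1 - int m"
      using hook_length_arm_leg[OF row col] b N ij by simp
    then show False
      using bead_row_end[OF _ row] no_bead_column_end[OF _ col] c
      unfolding core_profile_def by metis
  qed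
  then show "c \<in> cores N" using c by (simp add: cores_def)
qed

section \<open>Simple reflections on cores\<close>

text \<open>
  On the abacus, this exchanges the positions \<open>k\<close> and \<open>k + 1\<close> for every \<open>k\<close> congruent to \<open>r\<close>: the
  height at \<open>k\<close> is replaced by its mirror image between the two neighbouring heights.
\<close>

definition swap :: "nat \<Rightarrow> nat \<Rightarrow> (int \<Rightarrow> int) \<Rightarrow> int \<Rightarrow> int" where
  "swap N r h k = (if k mod int N = int r then h (k - 1) + h (k + 1) - h k else h k)"

lemma succ_mod_neq:
  fixes k :: int
  assumes "N \<ge> 2"
  shows "(k + 1) mod int N \<noteq> k mod int N" and "(k - 1) mod int N \<noteq> k mod int N"
proof -
  have "\<not> int N dvd 1" using assms by auto
  then show "(k + 1) mod int N \<noteq> k mod int N" and "(k - 1) mod int N \<noteq> k mod int N"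
    by (auto simp: mod_eq_dvd_iff)
qed

text \<open>
  The neighbouring contents \<open>k - 1\<close> and \<open>k + 1\<close> are in other residue classes than \<open>k\<close>, so their
  heights stay fixed and the mirror image is taken between the same two values again.
\<close>

lemma swap_swap:
  assumes "N \<ge> 2"
  shows "swap N r (swap N r h) = h"
proof
  fix k
  show "swap N r (swap N r h) k = h k"
    using succ_mod_neq[OF assms, of k] by (auto simp: swap_def)
qed

lemma bead_swap:
  assumes "N \<ge> 2"
  shows "bead (swap N r h) k \<longleftrightarrow>
    (if k mod int N = int r then bead h (k + 1)
     else if (k - 1) mod int N = int r then bead h (k - 1) else bead h k)"
  using succ_mod_neq(2)[OF assms, of k] by (auto simp: bead_def swap_def)

lemma profile_swap:
  assumes "N \<ge> 2" and "profile h"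
  shows "profile (swap N r h)"
  unfolding profile_def
proof (intro conjI allI)
  fix k
  show "swap N r h (k - 1) = swap N r h k \<or> swap N r h (k - 1) = swap N r h k + 1"
    using succ_mod_neq[OF assms(1), of k] profile_step[OF assms(2), of k]
      profile_step[OF assms(2), of "k - 1"] profile_step[OF assms(2), of "k + 1"]
    by (auto simp: swap_def algebra_simps)
next
  let ?F = "{k. h k \<noteq> max 0 (- k)}"
  have "{k. swap N r h k \<noteq> max 0 (- k)} \<subseteq>
      insert 0 (?F \<union> (\<lambda>k. k + 1) ` ?F \<union> (\<lambda>k. k - 1) ` ?F)"
  proof
    fix k assume k: "k \<in> {k. swap N r h k \<noteq> max 0 (- k)}"
    show "k \<in> insert 0 (?F \<union> (\<lambda>k. k + 1) ` ?F \<union> (\<lambda>k. k - 1) ` ?F)"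
    proof (rule ccontr)
      assume a: "\<not> ?thesis"
      then have "k \<noteq> 0" "h k = max 0 (- k)" by auto
      moreover have "h (k - 1) = max 0 (- (k - 1))"
        using a by (auto simp: image_iff dest!: spec[of _ "k - 1"])
      moreover have "h (k + 1) = max 0 (- (k + 1))"
        using a by (auto simp: image_iff dest!: spec[of _ "k + 1"])
      ultimately have "swap N r h k = max 0 (- k)" by (auto simp: swap_def)
      then show False using k by simp
    qed
  qed
  moreover have "finite ?F" using assms(2) by (simp add: profile_def)
  ultimately show "finite {k. swap N r h k \<noteq> max 0 (- k)}"
    by (meson finite_UnI finite_imageI finite_insert finite_subset)
qed

lemma core_profile_swap:
  assumes "N \<ge> 2" and "core_profile N h"
  shows "core_profile N (swap N r h)"
proof -
  have prof: "profile h" and shift: "\<And>k. bead h k \<Longrightarrow> bead h (k - int N)"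
    using assms(2) by (auto simp: core_profile_def)
  have "bead (swap N r h) (k - int N)" if "bead (swap N r h) k" for k
  proof -
    have "(k - int N) mod int N = k mod int N" "(k - int N - 1) mod int N = (k - 1) mod int N"
      using mod_add_self2[of "k - int N" "int N"] mod_add_self2[of "k - int N - 1" "int N"] by (simp_all)
    then show ?thesis
      using that shift[of k] shift[of "k + 1"] shift[of "k - 1"]
      by (simp add: bead_swap[OF assms(1)] algebra_simps split: if_splits)
  qed
  then show ?thesis using profile_swap[OF assms(1) prof] by (simp add: core_profile_def)
qed

lemma core_profile_shift:
  assumes "core_profile N h" and "k mod int N = l mod int N" and "k \<le> l" and "bead h l"
  shows "bead h k"
proof -
  obtain q where q: "l - k = int N * q" using assms(2) by (metis mod_eq_dvd_iff dvdE)
  have "bead h (l - int N * int t)" for t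
  proof (induction t)
    case (Suc t)
    then have "bead h (l - int N * int t - int N)" using assms(1) by (simp add: core_profile_def)
    then show ?case by (simp add: algebra_simps)
  qed (use assms(4) in simp)
  then have shift: "bead h (l - int N * int t)" for t .
  show ?thesis
  proof (cases "k = l")
    case False
    then have "int N * q > 0" using q assms(3) by simp
    then have "q \<ge> 0" by (simp add: zero_less_mult_iff)
    then have "k = l - int N * int (nat q)" using q by simp
    then show ?thesis using shift by metis
  qed (use assms(4) in simp)
qed

lemma addable_nodes_iff:
  assumes "is_partition c" and "r < N"
  shows "b \<in> addable_nodes N r c \<longleftrightarrow> content b mod int N = int r \<and>
     int (fst b) = height c (content b) \<and>
     bead (height c) (content b) \<and> \<not> bead (height c) (content b + 1)"
proof -
  let ?h = "height c" and ?k = "content b"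
  have "b \<in> addable_nodes N r c \<longleftrightarrow>
      residue N b = r \<and> b \<notin> c \<and> is_partition (insert b c)"
    by (auto simp: addable_nodes_def)
  moreover have "residue N b = r \<longleftrightarrow> ?k mod int N = int r"
    using assms(2) by (intro residue_eq_iff) simp
  moreover have "?h (?k + 1) = ?h ?k \<longleftrightarrow> \<not> bead ?h (?k + 1)"
    using profile_step[OF profile_height[OF assms(1)], of "?k + 1"]
    unfolding bead_def add_diff_cancel_right' by arith
  ultimately show ?thesis unfolding addable_iff[OF assms(1)] bead_def[of _ ?k] by blast
qed

lemma removable_nodes_iff:
  assumes "is_partition c" and "r < N"
  shows "b \<in> removable_nodes N r c \<longleftrightarrow> content b mod int N = int r \<and>
     int (fst b) = height c (content b) - 1 \<and>
     \<not> bead (height c) (content b) \<and> bead (height c) (content b + 1)"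
proof -
  let ?h = "height c" and ?k = "content b"
  have "b \<in> removable_nodes N r c \<longleftrightarrow>
      residue N b = r \<and> b \<in> c \<and> is_partition (c - {b})"
    by (auto simp: removable_nodes_def)
  moreover have "residue N b = r \<longleftrightarrow> ?k mod int N = int r"
    using assms(2) by (intro residue_eq_iff) simp
  moreover have "?h (?k - 1) = ?h ?k \<longleftrightarrow> \<not> bead ?h ?k"
    using profile_step[OF profile_height[OF assms(1)], of ?k] unfolding bead_def by arith
  moreover have "?h (?k + 1) = ?h ?k - 1 \<longleftrightarrow> bead ?h (?k + 1)"
    by (auto simp: bead_def)
  ultimately show ?thesis unfolding removable_iff[OF assms(1)] by blast
qed

text \<open>
  In a core, an addable node of residue \<open>r\<close> at content \<open>k\<close> and a removable one at content \<open>l\<close>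
  exclude each other: the first gives a bead at \<open>k\<close> and a gap at \<open>k + 1\<close>, the second a gap at \<open>l\<close>
  and a bead at \<open>l + 1\<close>. If \<open>l \<le> k\<close>, shifting the bead at \<open>k\<close> to the left hits the gap at \<open>l\<close>;
  otherwise, shifting the bead at \<open>l + 1\<close> hits the gap at \<open>k + 1\<close>. Hence all corners of residue \<open>r\<close> are of the same kind, and exchanging the
  positions \<open>k\<close> and \<open>k + 1\<close> everywhere either adds or removes all of them.
\<close>

lemma core_reflection_eq_diagram_swap:
  assumes "N \<ge> 2" and "r < N" and "c \<in> cores N"
  shows "core_reflection N r c = diagram (swap N r (height c))"
proof -
  let ?h = "height c"
  have part: "is_partition c" and core: "core_profile N ?h"
    using assms(1,3) cores_iff_core_profile[of N c] by auto
  note mem = mem_iff_less_height[OF part]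
  note add = addable_nodes_iff[OF part assms(2)]
  note rem = removable_nodes_iff[OF part assms(2)]
  note step = profile_step[OF profile_height[OF part]]
  show ?thesis
  proof (cases "removable_nodes N r c = {}")
    case True
    have no_rem: "bead ?h k \<or> \<not> bead ?h (k + 1)" if k: "k mod int N = int r" for k
    proof (rule ccontr)
      assume a: "\<not> ?thesis"
      define i where "i = nat (?h k - 1)"
      have "?h (k - 1) = ?h k" "?h (k + 1) = ?h k - 1" using a step[of k] by (auto simp: bead_def)
      then have i: "int i = ?h k - 1" "int i + k \<ge> 0"
        using height_lower[of "k - 1" c] height_lower[of "k + 1" c] by (auto simp: i_def)
      then have "(i, nat (int i + k)) \<in> removable_nodes N r c"
        using a k by (simp add: rem content_def)
      then show False using True by blast
    qed
    have "b \<in> c \<union> addable_nodes N r c \<longleftrightarrow> int (fst b) < swap N r ?h (content b)" for b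
      using no_rem[of "content b"] step[of "content b"] step[of "content b + 1"]
      by (auto simp: mem add swap_def bead_def)
    then have "c \<union> addable_nodes N r c = diagram (swap N r ?h)"
      unfolding diagram_def mem_Collect_eq by blast
    then show ?thesis using True by (simp add: core_reflection_def)
  next
    case False
    then obtain b0 where "b0 \<in> removable_nodes N r c" by blast
    then obtain l where l: "l mod int N = int r" "\<not> bead ?h l" "bead ?h (l + 1)"
      by (auto simp: rem)
    have no_add: "\<not> bead ?h k \<or> bead ?h (k + 1)" if k: "k mod int N = int r" for k
    proof (rule ccontr)
      assume a: "\<not> ?thesis"
      show False
      proof (cases "k \<le> l")
        case True
        moreover have "(k + 1) mod int N = (l + 1) mod int N"
          using k l(1) by (metis mod_add_left_eq)
        ultimately show False using core_profile_shift[OF core, of "k + 1" "l + 1"] a l by simp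
      next
        case False
        then show False using core_profile_shift[OF core, of l k] a k l by simp
      qed
    qed
    have "b \<in> c - removable_nodes N r c \<longleftrightarrow> int (fst b) < swap N r ?h (content b)" for b
      using no_add[of "content b"] step[of "content b"] step[of "content b + 1"]
      by (auto simp: mem rem swap_def bead_def)
    then have "c - removable_nodes N r c = diagram (swap N r ?h)"
      unfolding diagram_def mem_Collect_eq by blast
    then show ?thesis using False by (simp add: core_reflection_def)
  qed
qed

lemma height_core_reflection:
  assumes "N \<ge> 2" and "r < N" and "c \<in> cores N"
  shows "height (core_reflection N r c) = swap N r (height c)"
proof -
  have "profile (height c)" using assms(3) by (simp add: cores_def profile_height)
  then show ?thesis
    using core_reflection_eq_diagram_swap[OF assms] height_diagram profile_swap[OF assms(1)] by simp
qed

lemma core_reflection_cores: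
  assumes "N \<ge> 2" and "r < N" and "c \<in> cores N"
  shows "core_reflection N r c \<in> cores N"
proof -
  have c: "core_profile N (height c)" using assms cores_iff_core_profile[of N c] by auto
  then have "is_partition (core_reflection N r c)"
    using core_reflection_eq_diagram_swap[OF assms] is_partition_diagram profile_swap[OF assms(1)]
    by (simp add: core_profile_def)
  then show ?thesis
    using cores_iff_core_profile[of N] core_profile_swap[OF assms(1) c]
      height_core_reflection[OF assms] assms(1) by simp
qed

lemma cores_eqI:
  assumes "c \<in> cores N" and "d \<in> cores N" and "height c = height d"
  shows "c = d"
proof -
  have "c = diagram (height c)" using assms(1) by (simp add: cores_def diagram_height)
  also have "\<dots> = d" unfolding assms(3) using assms(2) by (simp add: cores_def diagram_height)
  finally show ?thesis .
qed

lemma core_reflection_involution: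
  assumes "N \<ge> 2" and "r < N" and "c \<in> cores N"
  shows "core_reflection N r (core_reflection N r c) = c"
  using assms
  by (intro cores_eqI[of _ N]) (simp_all add: core_reflection_cores height_core_reflection swap_swap)


section \<open>Weights of cores\<close>

definition core_weight :: "nat \<Rightarrow> box set \<Rightarrow> weight" where
  "core_weight n c =
     (\<lambda>k. fundamental_weight 0 k - (\<Sum>b\<in>c. simple_root_A n (residue (2 * n) b) k))"

text \<open>
  The shift \<open>e\<close> allows the same set \<open>K\<close> to index the neighbouring diagonals on both sides.
\<close>

lemma sum_over_diagonals:
  fixes g :: "int \<Rightarrow> real"
  assumes "finite c" and "finite K" and "(\<lambda>b. content b - e) ` c \<subseteq> K"
  shows "(\<Sum>b\<in>c. g (content b - e)) = (\<Sum>k\<in>K. real (card (diagonal c (k + e))) * g k)"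
proof -
  have "(\<Sum>b\<in>c. g (content b - e)) =
      (\<Sum>k\<in>K. \<Sum>b | b \<in> c \<and> content b - e = k. g (content b - e))"
    using sum.group[OF assms, of "\<lambda>b. g (content b - e)"] by simp
  also have "\<dots> = (\<Sum>k\<in>K. real (card (diagonal c (k + e))) * g k)"
  proof (rule sum.cong[OF refl])
    fix k
    have "{b. b \<in> c \<and> content b - e = k} = diagonal c (k + e)" by (auto simp: diagonal_def)
    then show "(\<Sum>b | b \<in> c \<and> content b - e = k. g (content b - e)) =
        real (card (diagonal c (k + e))) * g k" by (simp add: diagonal_def)
  qed
  finally show ?thesis .
qed

definition second_difference :: "(int \<Rightarrow> int) \<Rightarrow> int \<Rightarrow> int" where
  "second_difference h k = h (k - 1) + h (k + 1) - 2 * h k"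

text \<open>
  Only the heights at contents \<open>k\<close> congruent to \<open>r\<close> change, each by the second difference of the
  profile at \<open>k\<close>, and all boxes concerned have residue \<open>r\<close>.
\<close>

lemma sum_core_reflection:
  fixes g :: "nat \<Rightarrow> real"
  assumes "N \<ge> 2" and "r < N" and "c \<in> cores N"
    and "finite K" and "content ` (c \<union> core_reflection N r c) \<subseteq> K"
  shows "(\<Sum>b\<in>core_reflection N r c. g (residue N b)) = (\<Sum>b\<in>c. g (residue N b)) +
     real_of_int (\<Sum>k | k \<in> K \<and> k mod int N = int r. second_difference (height c) k) * g r"
proof -
  let ?d = "core_reflection N r c"
  let ?g = "\<lambda>k. g (nat (k mod int N))"
  have fin: "finite c" "finite ?d"
    using assms(3) core_reflection_cores[OF assms(1-3)] by (auto simp: cores_def is_partition_finite)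
  have "(\<Sum>b\<in>?d. g (residue N b)) - (\<Sum>b\<in>c. g (residue N b)) =
      (\<Sum>k\<in>K. real (card (diagonal ?d k)) * ?g k) - (\<Sum>k\<in>K. real (card (diagonal c k)) * ?g k)"
    using sum_over_diagonals[of ?d K 0 ?g] sum_over_diagonals[of c K 0 ?g] fin assms(4,5)
    by (simp add: residue_content image_Un)
  also have "\<dots> = (\<Sum>k\<in>K. real_of_int (height ?d k - height c k) * ?g k)"
    by (simp add: sum_subtractf[symmetric] height_def algebra_simps)
  also have "\<dots> = (\<Sum>k\<in>K. if k mod int N = int r
      then real_of_int (second_difference (height c) k) * g r else 0)"
    by (rule sum.cong)
      (auto simp: height_core_reflection[OF assms(1-3)] swap_def second_difference_def)
  also have "\<dots> = (\<Sum>k | k \<in> K \<and> k mod int N = int r.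
      real_of_int (second_difference (height c) k) * g r)"
    by (rule sum.inter_filter[OF assms(4), symmetric])
  also have "\<dots> =
      real_of_int (\<Sum>k | k \<in> K \<and> k mod int N = int r. second_difference (height c) k) * g r"
    by (simp add: sum_distrib_right)
  finally show ?thesis by simp
qed

lemma cartan_A_residue:
  assumes "n \<ge> 2" and "r < 2 * n"
  shows "cartan_A n r (residue (2 * n) b) =
    2 * of_bool (content b mod int (2 * n) = int r)
    - of_bool ((content b - 1) mod int (2 * n) = int r)
    - of_bool ((content b + 1) mod int (2 * n) = int r)"
proof -
  let ?N = "int (2 * n)" and ?x = "content b" and ?j = "residue (2 * n) b"
  have j: "int ?j = ?x mod ?N" using assms by (simp add: residue_content)
  have r: "int r mod ?N = int r" using assms(2) by simp
  have "r = ?j \<longleftrightarrow> ?x mod ?N = int r" using j by auto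
  moreover have "?j = (r + 1) mod (2 * n) \<longleftrightarrow> (?x - 1) mod ?N = int r"
  proof -
    have "?j = (r + 1) mod (2 * n) \<longleftrightarrow> ?x mod ?N = (int r + 1) mod ?N"
      using j by (metis of_nat_1 of_nat_add of_nat_eq_iff of_nat_mod)
    also have "\<dots> \<longleftrightarrow> (?x - 1) mod ?N = int r mod ?N"
      by (simp add: mod_eq_dvd_iff algebra_simps)
    finally show ?thesis using r by simp
  qed
  moreover have "r = (?j + 1) mod (2 * n) \<longleftrightarrow> (?x + 1) mod ?N = int r"
  proof -
    have "r = (?j + 1) mod (2 * n) \<longleftrightarrow> int r = (int ?j + 1) mod ?N"
      by (metis of_nat_1 of_nat_add of_nat_eq_iff of_nat_mod)
    also have "\<dots> \<longleftrightarrow> int r = (?x + 1) mod ?N" by (simp only: j mod_add_left_eq)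
    finally show ?thesis by auto
  qed
  moreover have "(?x - 1) mod ?N \<noteq> (?x + 1) mod ?N"
  proof
    assume "(?x - 1) mod ?N = (?x + 1) mod ?N"
    then have "?N dvd (?x - 1) - (?x + 1)" by (simp only: mod_eq_dvd_iff)
    then have "?N dvd 2" by (simp add: algebra_simps)
    then have "?N \<le> 2" by (rule zdvd_imp_le) simp
    then show False using assms(1) by simp
  qed
  moreover have "(?x - 1) mod ?N \<noteq> ?x mod ?N" "(?x + 1) mod ?N \<noteq> ?x mod ?N"
    using succ_mod_neq[of "2 * n"] assms(1) by simp_all
  ultimately show ?thesis by (auto simp: cartan_A_def)
qed

text \<open>
  The row \<open>r\<close> of the Cartan matrix is the discrete Laplacian on the cycle, so applied to the numbers
  of boxes of each residue it adds up, with a minus sign, their second differences along the diagonals of content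
  congruent to \<open>r\<close>. The height differs from the number of boxes on the diagonal by \<open>max 0 (- k)\<close>,
  whose second difference is 1 at 0 and vanishes elsewhere; this accounts for \<open>\<Lambda>\<^sub>0\<close>.
\<close>

lemma coroot_pairing_core_weight:
  assumes "n \<ge> 2" and "r < 2 * n" and "finite c" and "finite K" and "0 \<in> K"
    and K: "\<And>b. b \<in> c \<Longrightarrow> {content b - 1, content b, content b + 1} \<subseteq> K"
  shows "coroot_pairing (core_weight n c) r = real_of_int
     (\<Sum>k | k \<in> K \<and> k mod int (2 * n) = int r. second_difference (height c) k)"
proof -
  let ?N = "int (2 * n)"
  let ?K = "{k \<in> K. k mod ?N = int r}"
  let ?d = "\<lambda>k. real (card (diagonal c k))"
  have count: "(\<Sum>b\<in>c. of_bool ((content b - e) mod ?N = int r)) = (\<Sum>k\<in>?K. ?d (k + e))"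
    if "e \<in> {-1, 0, 1}" for e
  proof -
    have sub: "(\<lambda>b. content b - e) ` c \<subseteq> K" using K that by auto
    have "(\<Sum>b\<in>c. of_bool ((content b - e) mod ?N = int r)) =
        (\<Sum>k\<in>K. ?d (k + e) * of_bool (k mod ?N = int r))"
      by (rule sum_over_diagonals[OF assms(3,4) sub])
    also have "\<dots> = (\<Sum>k\<in>K. if k mod ?N = int r then ?d (k + e) else 0)"
      by (rule sum.cong) auto
    also have "\<dots> = (\<Sum>k\<in>?K. ?d (k + e))" by (rule sum.inter_filter[OF assms(4), symmetric])
    finally show ?thesis .
  qed
  have "(\<Sum>b\<in>c. cartan_A n r (residue (2 * n) b)) =
      2 * (\<Sum>b\<in>c. of_bool (content b mod ?N = int r))
      - (\<Sum>b\<in>c. of_bool ((content b - 1) mod ?N = int r))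
      - (\<Sum>b\<in>c. of_bool ((content b + 1) mod ?N = int r))"
    by (simp only: cartan_A_residue[OF assms(1,2)] sum_subtractf sum_distrib_left)
  also have "\<dots> = 2 * (\<Sum>k\<in>?K. ?d k) - (\<Sum>k\<in>?K. ?d (k + 1)) - (\<Sum>k\<in>?K. ?d (k - 1))"
    using count[of 0] count[of 1] count[of "-1"] by simp
  also have "\<dots> = (\<Sum>k\<in>?K. 2 * ?d k - ?d (k + 1) - ?d (k - 1))"
    by (simp only: sum_subtractf sum_distrib_left)
  finally have cartan: "(\<Sum>b\<in>c. cartan_A n r (residue (2 * n) b)) =
      (\<Sum>k\<in>?K. 2 * ?d k - ?d (k + 1) - ?d (k - 1))" .
  have "(\<Sum>k\<in>?K. of_bool (k = 0)) = (of_bool (r = 0) :: real)"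
  proof -
    have "0 \<in> ?K \<longleftrightarrow> r = 0" using assms(5) by auto
    moreover have "finite ?K" using assms(4) by simp
    ultimately show ?thesis by (simp add: of_bool_def)
  qed
  moreover have "real_of_int (second_difference (height c) k) =
      of_bool (k = 0) - (2 * ?d k - ?d (k + 1) - ?d (k - 1))" for k
    by (auto simp: second_difference_def height_def max_def)
  ultimately have "real_of_int (\<Sum>k\<in>?K. second_difference (height c) k) =
      of_bool (r = 0) - (\<Sum>b\<in>c. cartan_A n r (residue (2 * n) b))"
    by (simp add: cartan sum_subtractf)
  then show ?thesis
    using assms(2)
    by (simp add: coroot_pairing_def core_weight_def fundamental_weight_def simple_root_A_def)
qed

text \<open>
  The reflections change both sides by a multiple of \<open>\<alpha>\<^sub>r\<close>, and the multiple is the same sum of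
  second differences.
\<close>

theorem core_weight_core_reflection:
  assumes "n \<ge> 2" and "r < 2 * n" and "c \<in> cores (2 * n)"
  shows "core_weight n (core_reflection (2 * n) r c) = reflection_A n r (core_weight n c)"
proof
  fix k
  let ?N = "2 * n"
  let ?d = "core_reflection ?N r c"
  have N: "?N \<ge> 2" using assms(1) by simp
  have fin: "finite c" "finite ?d"
    using assms(3) core_reflection_cores[OF N assms(2,3)]
    by (auto simp: cores_def is_partition_finite)
  define S where "S = content ` (c \<union> ?d)"
  \<comment> \<open>All contents in sight together with their neighbours, so that shifted sums still run over \<open>K\<close>.\<close>
  define K where "K = insert 0 (S \<union> (\<lambda>k. k - 1) ` S \<union> (\<lambda>k. k + 1) ` S)"
  have K: "finite K" "content ` (c \<union> ?d) \<subseteq> K" "0 \<in> K"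
    using fin by (auto simp: K_def S_def)
  have near: "{content b - 1, content b, content b + 1} \<subseteq> K" if "b \<in> c" for b
    using that unfolding K_def S_def by blast
  have pairing: "coroot_pairing (core_weight n c) r = real_of_int
      (\<Sum>k | k \<in> K \<and> k mod int ?N = int r. second_difference (height c) k)"
    using near by (intro coroot_pairing_core_weight[OF assms(1,2) fin(1) K(1,3)])
  have "(\<Sum>b\<in>?d. simple_root_A n (residue ?N b) k) = (\<Sum>b\<in>c. simple_root_A n (residue ?N b) k) +
      coroot_pairing (core_weight n c) r * simple_root_A n r k"
    unfolding pairing
    by (rule sum_core_reflection[OF N assms(2,3) K(1,2), of "\<lambda>i. simple_root_A n i k"])
  then show "core_weight n ?d k = reflection_A n r (core_weight n c) k"
    by (simp add: core_weight_def reflection_A_def)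
qed

lemma core_weight_empty: "core_weight n {} = fundamental_weight 0"
  by (simp add: core_weight_def)

lemma empty_in_cores: "{} \<in> cores N"
  by (simp add: cores_def is_partition_def)

text \<open>
  The coefficient of \<open>\<delta>\<close> in the weight is minus the number of boxes of residue 0, and every nonempty
  partition contains the box \<open>(0, 0)\<close>.
\<close>

lemma core_weight_eq_fundamental_weight:
  assumes "is_partition c" and "core_weight n c = fundamental_weight 0"
  shows "c = {}"
proof (rule ccontr)
  assume "c \<noteq> {}"
  then obtain i j where "(i, j) \<in> c" by auto
  then have "(0, 0) \<in> c" using is_partitionD[OF assms(1), of i j 0 0] by simp
  moreover have "(\<Sum>b\<in>c. simple_root_A n (residue (2 * n) b) None) = 0"
    using fun_cong[OF assms(2), of None] by (simp add: core_weight_def)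
  then have "\<forall>b\<in>c. simple_root_A n (residue (2 * n) b) None = 0"
    using is_partition_finite[OF assms(1)]
    by (subst (asm) sum_nonneg_eq_0_iff) (auto simp: simple_root_A_def)
  ultimately show False by (auto simp: simple_root_A_def residue_def)
qed

section \<open>Words in the simple reflections\<close>

lemma word_prod_Nil: "word_prod s [] x = x"
  and word_prod_Cons: "word_prod s (i # is) x = s i (word_prod s is x)"
  by (simp_all add: word_prod_def)

lemma word_prod_append: "word_prod s (is @ js) = word_prod s is \<circ> word_prod s js"
  by (induction "is") (auto simp: word_prod_def)

lemma word_prod_rev:
  assumes "\<And>i x. i \<in> set is \<Longrightarrow> s i (s i x) = x"
  shows "word_prod s (rev is) (word_prod s is x) = x"
  using assms by (induction "is") (auto simp: word_prod_Nil word_prod_Cons word_prod_append)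

lemma mult_BijGroup_UNIV:
  "f \<in> carrier (BijGroup UNIV) \<Longrightarrow> g \<in> carrier (BijGroup UNIV) \<Longrightarrow>
    f \<otimes>\<^bsub>BijGroup UNIV\<^esub> g = f \<circ> g"
  by (auto simp: BijGroup_def compose_def)

lemma one_BijGroup_UNIV: "\<one>\<^bsub>BijGroup UNIV\<^esub> = id"
  by (auto simp: BijGroup_def)

context
  fixes s :: "nat \<Rightarrow> weight \<Rightarrow> weight" and I :: "nat set"
  assumes involution: "\<And>i x. i \<in> I \<Longrightarrow> s i (s i x) = x"
begin

lemma involution_carrier: "i \<in> I \<Longrightarrow> s i \<in> carrier (BijGroup UNIV)"
  using involution involuntory_imp_bij[of "s i"]
  by (simp add: BijGroup_def Bij_def bij_betw_def bij_def extensional_UNIV)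

lemma generators_carrier: "s ` I \<subseteq> carrier (BijGroup UNIV)"
  using involution_carrier by blast

lemma word_prod_in_generate:
  "set is \<subseteq> I \<Longrightarrow> word_prod s is \<in> generate (BijGroup UNIV) (s ` I)"
proof (induction "is")
  case Nil
  show ?case using generate.one[of "BijGroup UNIV" "s ` I"]
    by (simp add: word_prod_def one_BijGroup_UNIV id_def)
next
  case (Cons i "is")
  interpret group "BijGroup (UNIV :: weight set)" by (rule group_BijGroup)
  have gen: "s i \<in> generate (BijGroup UNIV) (s ` I)"
    "word_prod s is \<in> generate (BijGroup UNIV) (s ` I)"
    using Cons by (auto intro: generate.incl)
  then have "s i \<otimes>\<^bsub>BijGroup UNIV\<^esub> word_prod s is = word_prod s (i # is)"
    using generate_in_carrier[OF generators_carrier]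
    by (subst mult_BijGroup_UNIV) (auto simp: word_prod_def)
  then show ?case using generate.eng[OF gen] by simp
qed

lemma generate_obtains_word:
  assumes "w \<in> generate (BijGroup UNIV) (s ` I)"
  obtains "is" where "set is \<subseteq> I" and "word_prod s is = w"
proof -
  interpret group "BijGroup (UNIV :: weight set)" by (rule group_BijGroup)
  have "\<exists>is. set is \<subseteq> I \<and> word_prod s is = w" using assms
  proof (induction rule: generate.induct)
    case one
    show ?case by (rule exI[of _ "[]"]) (simp add: word_prod_def one_BijGroup_UNIV id_def)
  next
    case (incl h)
    then obtain i where "i \<in> I" "h = s i" by blast
    then show ?case by (intro exI[of _ "[i]"]) (simp add: word_prod_def)
  next
    case (inv h)
    then obtain i where i: "i \<in> I" "h = s i" by blast
    have "s i \<otimes>\<^bsub>BijGroup UNIV\<^esub> s i = \<one>\<^bsub>BijGroup UNIV\<^esub>"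
      using involution_carrier[OF i(1)] involution[OF i(1)]
      by (simp add: mult_BijGroup_UNIV one_BijGroup_UNIV fun_eq_iff)
    then have "inv\<^bsub>BijGroup UNIV\<^esub> h = s i"
      using inv_equality involution_carrier[OF i(1)] i(2) by simp
    then show ?case using i by (intro exI[of _ "[i]"]) (simp add: word_prod_def)
  next
    case (eng h1 h2)
    then obtain js ks where "set js \<subseteq> I" "word_prod s js = h1" "set ks \<subseteq> I" "word_prod s ks = h2"
      by blast
    moreover have "h1 \<otimes>\<^bsub>BijGroup UNIV\<^esub> h2 = h1 \<circ> h2"
      using eng.hyps generate_in_carrier[OF generators_carrier] by (intro mult_BijGroup_UNIV) auto
    ultimately show ?case by (intro exI[of _ "js @ ks"]) (simp add: word_prod_append)
  qed
  then show thesis using that by blast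
qed

end

lemma reflection_A_involution: "i < 2 * n \<Longrightarrow> reflection_A n i (reflection_A n i x) = x"
  by (auto simp: reflection_A_def coroot_pairing_def simple_root_A_def cartan_A_def)

lemma weyl_A_obtains_word:
  assumes "w \<in> weyl_A n"
  obtains "is" where "set is \<subseteq> {..<2 * n}" and "word_prod (reflection_A n) is = w"
proof -
  have "w \<in> generate (BijGroup UNIV) (reflection_A n ` {..<2 * n})"
    using assms by (simp add: weyl_A_def)
  then show thesis
    by (rule generate_obtains_word[rotated]) (use that reflection_A_involution in auto)
qed

lemma word_prod_reflection_A_scale:
  "word_prod (reflection_A n) is (\<lambda>k. a * x k) = (\<lambda>k. a * word_prod (reflection_A n) is x k)"
proof (induction "is")
  case (Cons i "is")
  then show ?case
    by (simp add: word_prod_Cons reflection_A_def coroot_pairing_def algebra_simps)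
qed (simp add: word_prod_Nil)

lemma foldr_core_reflection:
  assumes "n \<ge> 2" and "set is \<subseteq> {..<2 * n}" and "c \<in> cores (2 * n)"
  shows "foldr (core_reflection (2 * n)) is c \<in> cores (2 * n)"
    and "core_weight n (foldr (core_reflection (2 * n)) is c) =
      word_prod (reflection_A n) is (core_weight n c)"
    and "foldr (core_reflection (2 * n)) (rev is) (foldr (core_reflection (2 * n)) is c) = c"
proof -
  have N: "2 * n \<ge> 2" using assms(1) by simp
  have "foldr (core_reflection (2 * n)) is c \<in> cores (2 * n) \<and>
    core_weight n (foldr (core_reflection (2 * n)) is c) =
      word_prod (reflection_A n) is (core_weight n c) \<and>
    foldr (core_reflection (2 * n)) (rev is) (foldr (core_reflection (2 * n)) is c) = c"
    using assms(2)
  proof (induction "is")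
    case Nil
    then show ?case using assms(3) by (simp add: word_prod_Nil)
  next
    case (Cons i "is")
    then have i: "i < 2 * n" and IH: "foldr (core_reflection (2 * n)) is c \<in> cores (2 * n)"
      "core_weight n (foldr (core_reflection (2 * n)) is c) =
        word_prod (reflection_A n) is (core_weight n c)"
      "foldr (core_reflection (2 * n)) (rev is) (foldr (core_reflection (2 * n)) is c) = c"
      by auto
    then show ?case
      using core_reflection_cores[OF N i IH(1)] core_weight_core_reflection[OF assms(1) i IH(1)]
        core_reflection_involution[OF N i IH(1)]
      by (simp add: word_prod_Cons)
  qed
  then show "foldr (core_reflection (2 * n)) is c \<in> cores (2 * n)"
    and "core_weight n (foldr (core_reflection (2 * n)) is c) =
      word_prod (reflection_A n) is (core_weight n c)"
    and "foldr (core_reflection (2 * n)) (rev is) (foldr (core_reflection (2 * n)) is c) = c"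
    by blast+
qed

text \<open>
  Undoing the second word on the result of the first gives a core of weight \<open>\<Lambda>\<^sub>0\<close>, which is empty.
  Only the images of \<open>\<Lambda>\<^sub>0\<close> under the two words need to agree; this makes the core invariant under
  multiplication of the group element by the stabilizer of \<open>\<Lambda>\<^sub>0\<close> from the right.
\<close>

lemma foldr_core_reflection_cong:
  assumes n: "n \<ge> 2" and "is": "set is \<subseteq> {..<2 * n}" and js: "set js \<subseteq> {..<2 * n}"
    and eq: "word_prod (reflection_A n) is (fundamental_weight 0) =
      word_prod (reflection_A n) js (fundamental_weight 0)"
  shows "foldr (core_reflection (2 * n)) is {} = foldr (core_reflection (2 * n)) js {}"
proof -
  let ?f = "foldr (core_reflection (2 * n))"
  let ?d = "?f (rev js) (?f is {})"
  have c: "?f is {} \<in> cores (2 * n)" by (rule foldr_core_reflection(1)[OF n "is" empty_in_cores])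
  have rev: "set (rev js) \<subseteq> {..<2 * n}" using js by simp
  have d: "?d \<in> cores (2 * n)" by (rule foldr_core_reflection(1)[OF n rev c])
  have "core_weight n ?d =
      word_prod (reflection_A n) (rev js) (word_prod (reflection_A n) js (fundamental_weight 0))"
    by (simp add: foldr_core_reflection(2)[OF n rev c]
        foldr_core_reflection(2)[OF n "is" empty_in_cores] core_weight_empty eq)
  also have "\<dots> = fundamental_weight 0"
    using js reflection_A_involution by (intro word_prod_rev) auto
  finally have "?d = {}"
    using d by (intro core_weight_eq_fundamental_weight) (auto simp: cores_def)
  then show ?thesis using foldr_core_reflection(3)[OF n rev c] by simp
qed

lemma core_action_word_prod:
  assumes "n \<ge> 2" and "set is \<subseteq> {..<2 * n}"
  shows "core_action n (word_prod (reflection_A n) is) {} = foldr (core_reflection (2 * n)) is {}"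
  unfolding core_action_def
proof (rule the_equality)
  show "\<exists>js. set js \<subseteq> {..<2 * n} \<and> word_prod (reflection_A n) js = word_prod (reflection_A n) is \<and>
      foldr (core_reflection (2 * n)) js {} = foldr (core_reflection (2 * n)) is {}"
    using assms(2) by blast
next
  fix d
  assume "\<exists>js. set js \<subseteq> {..<2 * n} \<and>
      word_prod (reflection_A n) js = word_prod (reflection_A n) is \<and>
      foldr (core_reflection (2 * n)) js {} = d"
  then show "d = foldr (core_reflection (2 * n)) is {}"
    using foldr_core_reflection_cong[OF assms(1) _ assms(2)] by metis
qed

section \<open>Self-conjugate cores\<close>

definition generator_word :: "nat \<Rightarrow> nat \<Rightarrow> nat list" where
  "generator_word n i = (if i = 0 \<or> i = n then [i] else [i, 2 * n - i])"

text \<open>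
  The effect of the \<open>i\<close>-th generator of type C: both residue classes \<open>i\<close> and \<open>- i\<close> are mirrored at
  once. Describing the second class by \<open>- k\<close> makes the symmetry under conjugation evident and
  covers \<open>i = 0\<close> and \<open>i = n\<close>, where the two classes coincide.
\<close>

definition orbit_swap :: "nat \<Rightarrow> nat \<Rightarrow> (int \<Rightarrow> int) \<Rightarrow> int \<Rightarrow> int" where
  "orbit_swap n i h k =
     (if k mod int (2 * n) = int i \<or> (- k) mod int (2 * n) = int i
      then h (k - 1) + h (k + 1) - h k else h k)"

text \<open>
  Transposition maps the diagonal of content \<open>k\<close> to that of content \<open>- k\<close>; the summand \<open>k\<close> is the
  difference of the first rows of these two diagonals.
\<close>

lemma self_conjugate_iff:
  assumes "is_partition c"
  shows "conjugate c = c \<longleftrightarrow> (\<forall>k. height c (- k) = height c k + k)"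
proof
  assume c: "conjugate c = c"
  show "\<forall>k. height c (- k) = height c k + k"
  proof
    fix k
    have "diagonal c (- k) = prod.swap ` diagonal c k"
      using c by (force simp: diagonal_def content_def conjugate_def image_iff)
    moreover have "inj_on prod.swap (diagonal c k)" by (auto simp: inj_on_def)
    ultimately have "card (diagonal c (- k)) = card (diagonal c k)" by (simp add: card_image)
    then show "height c (- k) = height c k + k" by (simp add: height_def)
  qed
next
  assume sym: "\<forall>k. height c (- k) = height c k + k"
  have "(j, i) \<in> c \<longleftrightarrow> (i, j) \<in> c" for i j
    using sym[rule_format, of "int j - int i"]
    by (simp add: mem_iff_less_height[OF assms] content_def)
  then show "conjugate c = c" by (auto simp: conjugate_def)
qed

text \<open>
  As the modulus is even, the two residue classes of a generator consist of numbers of the same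
  parity. They therefore never contain neighbouring contents, so the two reflections do not
  interfere with each other.
\<close>

lemma mod_even_parity:
  fixes k :: int
  assumes "k mod int (2 * n) = int i \<or> (- k) mod int (2 * n) = int i"
  shows "even k \<longleftrightarrow> even i"
proof -
  have "even (x mod int (2 * n)) \<longleftrightarrow> even x" for x by (rule dvd_mod_iff) simp
  from this[of k] this[of "- k"] show ?thesis using assms by auto
qed

lemma uminus_mod_eq_iff:
  fixes k :: int
  assumes "0 < i" and "i < N"
  shows "(- k) mod int N = int i \<longleftrightarrow> k mod int N = int (N - i)"
proof -
  have "(- k) mod int N = int i \<longleftrightarrow> (- k) mod int N = int i mod int N" using assms by simp
  also have "\<dots> \<longleftrightarrow> int N dvd - k - int i" by (rule mod_eq_dvd_iff)
  also have "\<dots> \<longleftrightarrow> int N dvd k + int i"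
    using dvd_minus_iff[of "int N" "k + int i"] by simp
  also have "\<dots> \<longleftrightarrow> int N dvd k - int (N - i)"
  proof -
    have "k + int i = k - int (N - i) + int N" using assms by simp
    then show ?thesis by (metis dvd_add_left_iff dvd_refl)
  qed
  also have "\<dots> \<longleftrightarrow> k mod int N = int (N - i) mod int N" by (rule mod_eq_dvd_iff[symmetric])
  also have "int (N - i) mod int N = int (N - i)"
    using assms by (intro mod_pos_pos_trivial) auto
  finally show ?thesis .
qed

lemma generator_word_subset: "n \<ge> 2 \<Longrightarrow> i \<le> n \<Longrightarrow> set (generator_word n i) \<subseteq> {..<2 * n}"
  by (auto simp: generator_word_def)

lemma height_generator_word:
  assumes "n \<ge> 2" and "i \<le> n" and "c \<in> cores (2 * n)"
  shows "height (foldr (core_reflection (2 * n)) (generator_word n i) c) =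
    orbit_swap n i (height c)"
proof (cases "i = 0 \<or> i = n")
  case True
  have "(- k) mod int (2 * n) = int i \<longleftrightarrow> k mod int (2 * n) = int i" for k
  proof (cases "i = 0")
    case True
    then show ?thesis using dvd_minus_iff[of "int (2 * n)" k] by (simp only: mod_eq_0_iff_dvd of_nat_0)
  next
    case False
    then show ?thesis using True assms(1) by (subst uminus_mod_eq_iff) auto
  qed
  then show ?thesis
    using True assms
    by (auto simp: generator_word_def height_core_reflection orbit_swap_def swap_def fun_eq_iff)
next
  case False
  let ?N = "2 * n" and ?i' = "2 * n - i"
  have i: "0 < i" "i < n" "i < ?N" "?i' < ?N" using False assms by auto
  have N: "?N \<ge> 2" using assms(1) by simp
  have c': "core_reflection ?N ?i' c \<in> cores ?N" by (rule core_reflection_cores[OF N i(4) assms(3)])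
  have "swap ?N i (swap ?N ?i' h) k = orbit_swap n i h k" for h k
  proof (cases "k mod int ?N = int i")
    case True
    have "even k \<longleftrightarrow> even i" using mod_even_parity[of k n i] True by blast
    then have "(k + 1) mod int ?N \<noteq> int ?i'" "(k - 1) mod int ?N \<noteq> int ?i'"
      using mod_even_parity[of "k + 1" n ?i'] mod_even_parity[of "k - 1" n ?i'] i by auto
    moreover have "k mod int ?N \<noteq> int ?i'" using True i by simp
    ultimately show ?thesis using True unfolding swap_def orbit_swap_def by simp
  next
    case False
    then show ?thesis using uminus_mod_eq_iff[OF i(1,3), of k] unfolding swap_def orbit_swap_def by simp
  qed
  then show ?thesis
    using False height_core_reflection[OF N i(3) c'] height_core_reflection[OF N i(4) assms(3)]
    by (simp add: generator_word_def fun_eq_iff)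
qed

lemma orbit_swap_orbit_swap: "orbit_swap n i (orbit_swap n i h) = h"
proof
  fix k
  show "orbit_swap n i (orbit_swap n i h) k = h k"
  proof (cases "k mod int (2 * n) = int i \<or> (- k) mod int (2 * n) = int i")
    case True
    then have "even k \<longleftrightarrow> even i" by (rule mod_even_parity)
    then have "orbit_swap n i h (k + 1) = h (k + 1)" "orbit_swap n i h (k - 1) = h (k - 1)"
      using mod_even_parity[of "k + 1" n i] mod_even_parity[of "k - 1" n i]
      unfolding orbit_swap_def by auto
    moreover have "orbit_swap n i h k = h (k - 1) + h (k + 1) - h k"
      using True by (simp add: orbit_swap_def)
    moreover have "orbit_swap n i (orbit_swap n i h) k =
        orbit_swap n i h (k - 1) + orbit_swap n i h (k + 1) - orbit_swap n i h k"
      using True by (simp only: orbit_swap_def[of n i "orbit_swap n i h"] if_True)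
    ultimately show ?thesis by simp
  next
    case False
    then show ?thesis by (simp add: orbit_swap_def)
  qed
qed

lemma orbit_swap_symmetric:
  assumes "\<And>k. h (- k) = h k + k"
  shows "orbit_swap n i h (- k) = orbit_swap n i h k + k"
proof -
  have "h (- k - 1) = h (k + 1) + k + 1" "h (- k + 1) = h (k - 1) + k - 1"
    using assms[of "k + 1"] assms[of "k - 1"] by simp_all
  then show ?thesis using assms[of k] unfolding orbit_swap_def by auto
qed

lemma generator_word_involution:
  assumes "n \<ge> 2" and "i \<le> n" and "c \<in> cores (2 * n)"
  shows "foldr (core_reflection (2 * n)) (generator_word n i)
    (foldr (core_reflection (2 * n)) (generator_word n i) c) = c"
proof -
  note core = foldr_core_reflection(1)[OF assms(1) generator_word_subset[OF assms(1,2)]]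
  show ?thesis
    using height_generator_word[OF assms(1,2)] core assms(3) orbit_swap_orbit_swap
    by (intro cores_eqI[of _ "2 * n"]) auto
qed

lemma generator_word_self_conjugate:
  assumes "n \<ge> 2" and "i \<le> n" and "c \<in> self_conjugate_cores (2 * n)"
  shows "foldr (core_reflection (2 * n)) (generator_word n i) c \<in> self_conjugate_cores (2 * n)"
proof -
  let ?d = "foldr (core_reflection (2 * n)) (generator_word n i) c"
  have c: "c \<in> cores (2 * n)" "conjugate c = c" "is_partition c"
    using assms(3) by (auto simp: self_conjugate_cores_def cores_def)
  have d: "?d \<in> cores (2 * n)"
    by (rule foldr_core_reflection(1)[OF assms(1) generator_word_subset[OF assms(1,2)] c(1)])
  then have "is_partition ?d" by (simp add: cores_def)
  moreover have "height c (- k) = height c k + k" for k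
    using self_conjugate_iff[OF c(3)] c(2) by blast
  then have "\<forall>k. height ?d (- k) = height ?d k + k"
    unfolding height_generator_word[OF assms(1,2) c(1)] by (intro allI orbit_swap_symmetric)
  ultimately have "conjugate ?d = ?d" using self_conjugate_iff by blast
  then show ?thesis using d by (simp add: self_conjugate_cores_def)
qed

lemma is_partition_conjugate: "is_partition c \<Longrightarrow> is_partition (conjugate c)"
proof -
  assume c: "is_partition c"
  have "conjugate c = prod.swap ` c" by (force simp: conjugate_def image_iff)
  then have "finite (conjugate c)" using is_partition_finite[OF c] by simp
  then show ?thesis using is_partitionD[OF c] unfolding is_partition_def conjugate_def by auto
qed

lemma residue_transpose:
  assumes "N > 0"
  shows "residue N (j, i) = (if residue N (i, j) = 0 then 0 else N - residue N (i, j))"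
proof -
  let ?x = "int j - int i"
  have "(int i - int j) mod int N = (- ?x) mod int N" by simp
  also have "\<dots> = (if ?x mod int N = 0 then 0 else int N - ?x mod int N)"
    by (rule zmod_zminus1_eq_if)
  finally have "residue N (j, i) = nat (if ?x mod int N = 0 then 0 else int N - ?x mod int N)"
    by (simp add: residue_def)
  moreover have "?x mod int N \<ge> 0" "?x mod int N < int N" using assms by simp_all
  ultimately show ?thesis by (auto simp: residue_def nat_diff_distrib)
qed

lemma removable_nodes_transpose:
  assumes "conjugate c = c" and "0 < r" and "r < N" and "(i, j) \<in> removable_nodes N r c"
  shows "(j, i) \<in> removable_nodes N (N - r) c"
proof -
  have "is_partition (conjugate (c - {(i, j)}))"
    using assms(4) by (intro is_partition_conjugate) (simp add: removable_nodes_def)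
  also have "conjugate (c - {(i, j)}) = conjugate c - {(j, i)}" by (auto simp: conjugate_def)
  finally have "is_partition (c - {(j, i)})" using assms(1) by simp
  moreover have "(j, i) \<in> c" using assms(1,4) by (auto simp: removable_nodes_def conjugate_def)
  moreover have "residue N (j, i) = N - r"
    using residue_transpose[of N j i] assms by (simp add: removable_nodes_def)
  ultimately show ?thesis by (simp add: removable_nodes_def)
qed

text \<open>
  A box that maximizes the sum of its coordinates is an outer corner.
\<close>

lemma exists_removable_node:
  assumes "is_partition c" and "c \<noteq> {}"
  obtains b where "b \<in> removable_nodes N (residue N b) c"
proof -
  note fin = is_partition_finite[OF assms(1)]
  obtain b where b: "b \<in> c" "\<And>x. x \<in> c \<Longrightarrow> fst x + snd x \<le> fst b + snd b"
    using Max_ge[of "(\<lambda>b. fst b + snd b) ` c"] Max_in[of "(\<lambda>b. fst b + snd b) ` c"] fin assms(2)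
    by (smt (verit) finite_imageI image_iff image_is_empty)
  have "is_partition (c - {b})"
    unfolding is_partition_def
  proof (intro conjI allI impI)
    show "finite (c - {b})" using fin by simp
    fix i j i' j'
    assume a: "(i, j) \<in> c - {b}" "i' \<le> i" "j' \<le> j"
    then have "(i', j') \<in> c" using is_partitionD[OF assms(1)] by blast
    moreover have "(i', j') \<noteq> b" using b(2)[of "(i, j)"] a by auto
    ultimately show "(i', j') \<in> c - {b}" by simp
  qed
  then show thesis using that b(1) by (simp add: removable_nodes_def)
qed

lemma core_reflection_removes:
  assumes "finite c" and "removable_nodes N r c \<noteq> {}"
  shows "card (core_reflection N r c) < card c"
  using assms by (auto simp: core_reflection_def removable_nodes_def intro!: psubset_card_mono)

text \<open>
  Removability of a node of content \<open>k\<close> depends on the heights at \<open>k - 1\<close>, \<open>k\<close> and \<open>k + 1\<close> only, and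
  the reflection with index \<open>2n - i\<close> changes none of these.
\<close>

lemma removable_nodes_opposite_reflection:
  assumes "n \<ge> 2" and "0 < i" and "i < n" and "c \<in> cores (2 * n)"
  shows "removable_nodes (2 * n) i c \<subseteq>
    removable_nodes (2 * n) i (core_reflection (2 * n) (2 * n - i) c)"
proof
  let ?N = "2 * n" and ?h = "height c"
  let ?d = "core_reflection ?N (?N - i) c"
  have N: "?N \<ge> 2" and i: "i < ?N" "?N - i < ?N" using assms by auto
  have part: "is_partition c" "is_partition ?d"
    using assms(4) core_reflection_cores[OF N i(2) assms(4)] by (auto simp: cores_def)
  fix b assume b: "b \<in> removable_nodes ?N i c"
  let ?k = "content b"
  have k: "?k mod int ?N = int i" using b by (simp add: removable_nodes_iff[OF part(1) i(1)])
  then have "even ?k \<longleftrightarrow> even i" using mod_even_parity by blast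
  then have "(?k + 1) mod int ?N \<noteq> int (?N - i)" "(?k - 1) mod int ?N \<noteq> int (?N - i)"
    using mod_even_parity[of "?k + 1" n "?N - i"] mod_even_parity[of "?k - 1" n "?N - i"] i by auto
  moreover have "?k mod int ?N \<noteq> int (?N - i)" using k assms by simp
  ultimately have "height ?d ?k = ?h ?k" "height ?d (?k + 1) = ?h (?k + 1)"
    "height ?d (?k - 1) = ?h (?k - 1)"
    by (simp_all only: height_core_reflection[OF N i(2) assms(4)] swap_def if_False)
  then show "b \<in> removable_nodes ?N i ?d"
    using b unfolding removable_nodes_iff[OF part(1) i(1)] removable_nodes_iff[OF part(2) i(1)]
      bead_def by simp
qed

text \<open>
  Transposing a removable node gives one of opposite residue, so both factors of the corresponding
  generator remove boxes.
\<close>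

lemma exists_decreasing_generator:
  assumes "n \<ge> 2" and "c \<in> self_conjugate_cores (2 * n)" and "c \<noteq> {}"
  obtains i where "i \<le> n" and
    "card (foldr (core_reflection (2 * n)) (generator_word n i) c) < card c"
proof -
  let ?N = "2 * n"
  have c: "c \<in> cores ?N" "conjugate c = c" "is_partition c" "finite c"
    using assms(2) by (auto simp: self_conjugate_cores_def cores_def is_partition_finite)
  obtain b where b: "b \<in> removable_nodes ?N (residue ?N b) c"
    using exists_removable_node[OF c(3) assms(3)] .
  define r where "r = residue ?N b"
  have r: "r < ?N" using assms(1) by (simp add: r_def residue_less)
  show thesis
  proof (cases "r = 0 \<or> r = n")
    case True
    then show thesis
      using that[of r] core_reflection_removes[OF c(4), of ?N r] b
      by (auto simp: generator_word_def r_def[symmetric])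
  next
    case False
    define i where "i = (if r < n then r else ?N - r)"
    have i: "0 < i" "i < n" "i < ?N" "?N - i < ?N" using False r by (auto simp: i_def)
    have "(snd b, fst b) \<in> removable_nodes ?N (?N - r) c"
      using removable_nodes_transpose[OF c(2), of r ?N "fst b" "snd b"] False r b
      by (simp add: r_def[symmetric])
    then have ne: "removable_nodes ?N i c \<noteq> {}" "removable_nodes ?N (?N - i) c \<noteq> {}"
      using b r by (auto simp: i_def r_def[symmetric])
    let ?d = "core_reflection ?N (?N - i) c"
    have "?d \<in> cores ?N" using core_reflection_cores[OF _ i(4) c(1)] assms(1) by simp
    then have "finite ?d" by (simp add: cores_def is_partition_finite)
    then have "card (core_reflection ?N i ?d) < card ?d"
      using removable_nodes_opposite_reflection[OF assms(1) i(1,2) c(1)] ne(1)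
      by (intro core_reflection_removes) auto
    also have "card ?d < card c" by (rule core_reflection_removes[OF c(4) ne(2)])
    finally show thesis using that[of i] i by (simp add: generator_word_def)
  qed
qed

lemma self_conjugate_core_obtains_word:
  assumes "n \<ge> 2" and "c \<in> self_conjugate_cores (2 * n)"
  obtains "is" where "set is \<subseteq> {..n}" and
    "foldr (core_reflection (2 * n)) (concat (map (generator_word n) is)) {} = c"
proof -
  let ?f = "foldr (core_reflection (2 * n))"
  have "\<exists>is. set is \<subseteq> {..n} \<and> ?f (concat (map (generator_word n) is)) {} = c"
    using assms(2)
  proof (induction "card c" arbitrary: c rule: less_induct)
    case less
    show ?case
    proof (cases "c = {}")
      case True
      then show ?thesis by (intro exI[of _ "[]"]) simp
    next
      case False
      then obtain i where i: "i \<le> n" "card (?f (generator_word n i) c) < card c"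
        using exists_decreasing_generator[OF assms(1) less.prems] by blast
      obtain "is" where "is": "set is \<subseteq> {..n}"
        "?f (concat (map (generator_word n) is)) {} = ?f (generator_word n i) c"
        using less.hyps[OF i(2) generator_word_self_conjugate[OF assms(1) i(1) less.prems]] by blast
      have "c \<in> cores (2 * n)" using less.prems by (simp add: self_conjugate_cores_def)
      then have "?f (concat (map (generator_word n) (i # is))) {} = c"
        using "is"(2) generator_word_involution[OF assms(1) i(1)] by simp
      then show ?thesis using "is"(1) i(1) by (intro exI[of _ "i # is"]) auto
    qed
  qed
  then show thesis using that by blast
qed

section \<open>The Weyl group of type C\<close>

lemma word_prod_generator_C:
  "word_prod (generator_C n) is = word_prod (reflection_A n) (concat (map (generator_word n) is))"
  by (induction "is") (auto simp: word_prod_def generator_C_def generator_word_def)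

lemma generator_C_involution:
  assumes "n \<ge> 2" and "i \<le> n"
  shows "generator_C n i (generator_C n i x) = x"
proof (cases "i = 0 \<or> i = n")
  case True
  then show ?thesis using assms reflection_A_involution[of i n] by (auto simp: generator_C_def)
next
  case False
  let ?i' = "2 * n - i"
  have i: "0 < i" "i < n" "i < 2 * n" "?i' < 2 * n" using False assms by auto
  have "i \<noteq> (?i' + 1) mod (2 * n)" "?i' \<noteq> (i + 1) mod (2 * n)"
    using i by (cases "i = 1"; simp)+
  then have "simple_root_A n i (Some ?i') = 0" "simple_root_A n ?i' (Some i) = 0"
    using i by (auto simp: simple_root_A_def cartan_A_def)
  then have "reflection_A n ?i' (reflection_A n i y) = reflection_A n i (reflection_A n ?i' y)" for y
    by (simp add: reflection_A_def coroot_pairing_def fun_eq_iff algebra_simps)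
  then show ?thesis
    using False reflection_A_involution[OF i(3)] reflection_A_involution[OF i(4)]
    by (simp add: generator_C_def)
qed

lemma generator_C_fixes_Lambda0:
  assumes "0 < i" and "i \<le> n"
  shows "generator_C n i (fundamental_weight 0) = fundamental_weight 0"
proof -
  have "reflection_A n j (fundamental_weight 0) = fundamental_weight 0" if "0 < j" for j
    using that by (simp add: reflection_A_def coroot_pairing_def fundamental_weight_def)
  then show ?thesis using assms by (cases "i = n") (auto simp: generator_C_def)
qed

lemma finite_weyl_C_fixes_Lambda0:
  assumes "n \<ge> 2" and "u \<in> finite_weyl_C n"
  shows "u (fundamental_weight 0) = fundamental_weight 0"
proof -
  have "u \<in> generate (BijGroup UNIV) (generator_C n ` {1..n})"
    using assms(2) by (simp add: finite_weyl_C_def)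
  then obtain "is" where "set is \<subseteq> {1..n}" "word_prod (generator_C n) is = u"
    by (rule generate_obtains_word[rotated]) (use that generator_C_involution[OF assms(1)] in auto)
  moreover have "word_prod (generator_C n) is (fundamental_weight 0) = fundamental_weight 0"
    if "set is \<subseteq> {1..n}" for "is"
    using that by (induction "is") (auto simp: word_prod_Nil word_prod_Cons generator_C_fixes_Lambda0)
  ultimately show ?thesis by auto
qed

text \<open>
  A factor \<open>u\<close> that minimizes the length of \<open>w \<circ> u\<close> works: since the finite Weyl group is closed under
  multiplication, multiplying by another of its elements leads to a competitor of \<open>u\<close>.
\<close>

lemma exists_grassmannian_representative:
  assumes "n \<ge> 2" and "w \<in> weyl_C n"
  obtains u where "u \<in> finite_weyl_C n" and "w \<circ> u \<in> grassmannian_C n"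
proof -
  interpret group "BijGroup (UNIV :: weight set)" by (rule group_BijGroup)
  have inv: "generator_C n i (generator_C n i x) = x" if "i \<in> {..n}" for i x
    using generator_C_involution[OF assms(1)] that by simp
  note carrier = generators_carrier[of "{..n}" "generator_C n", OF inv]
  have fin_sub: "finite_weyl_C n \<subseteq> weyl_C n"
    unfolding finite_weyl_C_def weyl_C_def by (intro mono_generate) auto
  have in_carrier: "v \<in> carrier (BijGroup UNIV)" if "v \<in> weyl_C n" for v
    using that generate_in_carrier[OF carrier] by (simp add: weyl_C_def)
  have mult: "u \<otimes>\<^bsub>BijGroup UNIV\<^esub> v = u \<circ> v" if "u \<in> weyl_C n" "v \<in> weyl_C n" for u v
    using that by (intro mult_BijGroup_UNIV in_carrier)
  have closed: "u \<circ> v \<in> weyl_C n" if "u \<in> weyl_C n" "v \<in> weyl_C n" for u v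
    unfolding mult[OF that, symmetric] using that unfolding weyl_C_def by (rule generate.eng)
  have fin_closed: "u \<circ> v \<in> finite_weyl_C n" if "u \<in> finite_weyl_C n" "v \<in> finite_weyl_C n" for u v
    unfolding mult[OF that[THEN subsetD[OF fin_sub]], symmetric]
    using that unfolding finite_weyl_C_def by (rule generate.eng)
  have "\<one>\<^bsub>BijGroup UNIV\<^esub> \<in> finite_weyl_C n" by (simp add: finite_weyl_C_def generate.one)
  then obtain u where u: "u \<in> finite_weyl_C n"
    "\<And>v. v \<in> finite_weyl_C n \<Longrightarrow> length_C n (w \<circ> u) \<le> length_C n (w \<circ> v)"
    using ex_has_least_nat[of "\<lambda>u. u \<in> finite_weyl_C n" _ "\<lambda>u. length_C n (w \<circ> u)"] by blast
  have "length_C n (w \<circ> u) \<le> length_C n (w \<circ> u \<circ> v)" if "v \<in> finite_weyl_C n" for v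
    using u(2)[OF fin_closed[OF u(1) that]] by (simp add: comp_assoc)
  then have "w \<circ> u \<in> grassmannian_C n"
    using closed[OF assms(2)] u(1) fin_sub by (auto simp: grassmannian_C_def)
  then show thesis using that u(1) by blast
qed

section \<open>The coefficients of the atomic length\<close>

text \<open>
  The index of the simple root of type C that involves the simple root of type A indexed by the
  residue of the box.
\<close>

definition folded_residue :: "nat \<Rightarrow> box \<Rightarrow> nat" where
  "folded_residue n b = min (residue (2 * n) b) (2 * n - residue (2 * n) b)"

lemma simple_root_C_folded_residue:
  assumes "n \<ge> 2"
  shows "simple_root_C n (folded_residue n (i, j)) k =
    simple_root_A n (residue (2 * n) (i, j)) k + simple_root_A n (residue (2 * n) (j, i)) k"
proof -
  have "residue (2 * n) (i, j) < 2 * n" using assms by (intro residue_less) simp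
  moreover have "residue (2 * n) (j, i) =
      (if residue (2 * n) (i, j) = 0 then 0 else 2 * n - residue (2 * n) (i, j))"
    using assms by (intro residue_transpose) simp
  ultimately show ?thesis by (auto simp: folded_residue_def simple_root_C_def min_def)
qed

text \<open>
  One of the two copies of each box is replaced by the transposed box, which only permutes the
  boxes of a self-conjugate diagram.
\<close>

lemma sum_simple_root_C_self_conjugate:
  assumes "n \<ge> 2" and "conjugate c = c"
  shows "(\<Sum>b\<in>c. simple_root_C n (folded_residue n b) k) =
    2 * (\<Sum>b\<in>c. simple_root_A n (residue (2 * n) b) k)"
proof -
  have swap: "prod.swap ` c = c" using assms(2) by (force simp: conjugate_def image_iff)
  have "(\<Sum>b\<in>c. simple_root_C n (folded_residue n b) k) =
      (\<Sum>b\<in>c. simple_root_A n (residue (2 * n) b) k) +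
      (\<Sum>b\<in>c. simple_root_A n (residue (2 * n) (prod.swap b)) k)"
    unfolding sum.distrib[symmetric]
  proof (rule sum.cong[OF refl])
    fix b :: box
    show "simple_root_C n (folded_residue n b) k =
        simple_root_A n (residue (2 * n) b) k + simple_root_A n (residue (2 * n) (prod.swap b)) k"
      using simple_root_C_folded_residue[OF assms(1), of "fst b" "snd b" k] by (cases b) simp
  qed
  also have "(\<Sum>b\<in>c. simple_root_A n (residue (2 * n) (prod.swap b)) k) =
      (\<Sum>b\<in>prod.swap ` c. simple_root_A n (residue (2 * n) b) k)"
    by (subst sum.reindex) (auto simp: inj_on_def)
  finally show ?thesis by (simp add: swap)
qed

lemma simple_root_C_triangular:
  assumes "n \<ge> 2" and "j < n" and "i \<le> n"
  shows "Suc j < i \<Longrightarrow> simple_root_C n i (Some j) = 0"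
    and "Suc j = i \<Longrightarrow> simple_root_C n i (Some j) \<noteq> 0"
proof -
  have m: "(x + 1) mod (2 * n) = (if x + 1 = 2 * n then 0 else x + 1)" if "x < 2 * n" for x
    using that by auto
  show "Suc j < i \<Longrightarrow> simple_root_C n i (Some j) = 0"
    using assms m[of j] m[of i] m[of "2 * n - i"]
    by (auto simp: simple_root_C_def simple_root_A_def cartan_A_def)
  show "Suc j = i \<Longrightarrow> simple_root_C n i (Some j) \<noteq> 0"
    using assms m[of j] m[of i] m[of "2 * n - i"]
    by (auto simp: simple_root_C_def simple_root_A_def cartan_A_def)
qed

text \<open>
  The coefficient of \<open>\<delta>\<close> determines \<open>a 0\<close>, since no other simple root of type C involves \<open>\<alpha>\<^sub>0\<close>.
  Moving along the Dynkin diagram, the coefficient of \<open>\<Lambda>\<^sub>l\<close> then determines \<open>a (l + 1)\<close>, since the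
  roots with a larger index vanish there.
\<close>

lemma simple_root_C_independent:
  assumes n: "n \<ge> 2" and zero: "\<And>k. (\<Sum>i\<le>n. a i * simple_root_C n i k) = 0" and "j \<le> n"
  shows "a j = 0"
  using \<open>j \<le> n\<close>
proof (induction j rule: less_induct)
  case (less j)
  show ?case
  proof (cases j)
    case 0
    have "(\<Sum>i\<le>n. a i * simple_root_C n i None) = (\<Sum>i\<in>{0}. a i * simple_root_C n i None)"
      using n by (intro sum.mono_neutral_right) (auto simp: simple_root_C_def simple_root_A_def)
    then show ?thesis using zero[of None] 0 by (simp add: simple_root_C_def simple_root_A_def)
  next
    case (Suc l)
    have "a i * simple_root_C n i (Some l) = 0" if "i \<in> {..n} - {j}" for i
      using that less.IH[of i] less.prems Suc simple_root_C_triangular(1)[OF n, of l i]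
      by (cases "i < j") auto
    then have "(\<Sum>i\<le>n. a i * simple_root_C n i (Some l)) =
        (\<Sum>i\<in>{j}. a i * simple_root_C n i (Some l))"
      using less.prems by (intro sum.mono_neutral_right) auto
    then have "a j * simple_root_C n j (Some l) = 0" using zero[of "Some l"] by simp
    moreover have "simple_root_C n j (Some l) \<noteq> 0"
      by (rule simple_root_C_triangular(2)[OF n]) (use less.prems Suc in auto)
    ultimately show ?thesis by simp
  qed
qed

lemma Lambda0_C_minus_grassmannian:
  assumes n: "n \<ge> 2" and w: "w \<in> weyl_A n"
  shows "Lambda0_C k - w Lambda0_C k =
    2 * (\<Sum>b\<in>core_action n w {}. simple_root_A n (residue (2 * n) b) k)"
proof -
  obtain "is" where "is": "set is \<subseteq> {..<2 * n}" "word_prod (reflection_A n) is = w"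
    using weyl_A_obtains_word[OF w] .
  have "core_weight n (core_action n w {}) = w (fundamental_weight 0)"
    using core_action_word_prod[OF n "is"(1)] foldr_core_reflection(2)[OF n "is"(1) empty_in_cores]
    by (simp add: "is"(2) core_weight_empty)
  then have "w (fundamental_weight 0) k =
      fundamental_weight 0 k - (\<Sum>b\<in>core_action n w {}. simple_root_A n (residue (2 * n) b) k)"
    by (metis core_weight_def)
  moreover have "w Lambda0_C k = 2 * w (fundamental_weight 0) k"
    using word_prod_reflection_A_scale[of n "is" 2 "fundamental_weight 0"]
    by (simp add: "is"(2) Lambda0_C_def)
  ultimately show ?thesis by (simp add: Lambda0_C_def)
qed

text \<open>
  The word that builds \<open>c\<close> gives an element of the Weyl group of type C; its Grassmannian
  representative has the same effect on \<open>\<Lambda>\<^sub>0\<close> and hence on the empty core.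
\<close>

lemma exists_grassmannian_core_action:
  assumes n: "n \<ge> 2" and c: "c \<in> self_conjugate_cores (2 * n)"
  obtains w where "w \<in> grassmannian_C n" and "core_action n w {} = c"
proof -
  obtain "is" where "is": "set is \<subseteq> {..n}"
    and eq: "foldr (core_reflection (2 * n)) (concat (map (generator_word n) is)) {} = c"
    using self_conjugate_core_obtains_word[OF n c] .
  let ?js = "concat (map (generator_word n) is)"
  let ?v = "word_prod (generator_C n) is"
  have js: "set ?js \<subseteq> {..<2 * n}" using "is" generator_word_subset[OF n] by fastforce
  have "?v \<in> weyl_C n"
    unfolding weyl_C_def using generator_C_involution[OF n] "is" by (intro word_prod_in_generate) auto
  then obtain u where u: "u \<in> finite_weyl_C n" and w: "?v \<circ> u \<in> grassmannian_C n"
    using exists_grassmannian_representative[OF n] by blast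
  then have "?v \<circ> u \<in> weyl_A n" using weyl_C_subset_weyl_A[OF n] by (auto simp: grassmannian_C_def)
  then obtain ks where ks: "set ks \<subseteq> {..<2 * n}" "word_prod (reflection_A n) ks = ?v \<circ> u"
    by (rule weyl_A_obtains_word)
  have "core_action n (?v \<circ> u) {} = foldr (core_reflection (2 * n)) ks {}"
    using core_action_word_prod[OF n ks(1)] by (simp add: ks(2))
  also have "\<dots> = foldr (core_reflection (2 * n)) ?js {}"
    by (rule foldr_core_reflection_cong[OF n ks(1) js])
      (simp add: ks(2) finite_weyl_C_fixes_Lambda0[OF n u] word_prod_generator_C)
  finally show thesis using that[OF w] eq by simp
qed

lemma folded_residue_le: "folded_residue n b \<le> n"
  by (auto simp: folded_residue_def)

text \<open>
  The expansion holds for every Grassmannian element with core \<open>c\<close>, so the coefficients do not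
  depend on the choice of that element, and linear independence of the simple roots makes them
  unique.
\<close>

theorem coeff_C_self_conjugate:
  assumes n: "n \<ge> 2" and c: "c \<in> self_conjugate_cores (2 * n)" and "i \<le> n"
  shows "coeff_C n c i = real (card {b \<in> c. folded_residue n b = i})"
proof -
  have conj: "conjugate c = c" and fin: "finite c"
    using c by (auto simp: self_conjugate_cores_def cores_def is_partition_finite)
  define a where "a i = (if i \<le> n then real (card {b \<in> c. folded_residue n b = i}) else 0)" for i
  have expansion: "Lambda0_C k - w Lambda0_C k = (\<Sum>i\<le>n. a i * simple_root_C n i k)"
    if "w \<in> grassmannian_C n" "core_action n w {} = c" for w k
  proof -
    have "w \<in> weyl_A n" using that weyl_C_subset_weyl_A[OF n] by (auto simp: grassmannian_C_def)
    then have "Lambda0_C k - w Lambda0_C k = (\<Sum>b\<in>c. simple_root_C n (folded_residue n b) k)"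
      using Lambda0_C_minus_grassmannian[OF n] that(2) sum_simple_root_C_self_conjugate[OF n conj]
      by simp
    also have "\<dots> = (\<Sum>i\<le>n. \<Sum>b | b \<in> c \<and> folded_residue n b = i.
        simple_root_C n (folded_residue n b) k)"
      by (rule sum.group[symmetric]) (auto simp: fin folded_residue_le)
    also have "\<dots> = (\<Sum>i\<le>n. a i * simple_root_C n i k)"
      by (rule sum.cong) (auto simp: a_def)
    finally show ?thesis .
  qed
  have "coeff_C n c = a"
    unfolding coeff_C_def
  proof (rule the_equality)
    obtain w where "w \<in> grassmannian_C n" "core_action n w {} = c"
      using exists_grassmannian_core_action[OF n c] .
    then show "(\<forall>i>n. a i = 0) \<and> (\<exists>w\<in>grassmannian_C n. core_action n w {} = c \<and>
        (\<forall>k. Lambda0_C k - w Lambda0_C k = (\<Sum>i\<le>n. a i * simple_root_C n i k)))"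
      using expansion by (auto simp: a_def)
  next
    fix a'
    assume a': "(\<forall>i>n. a' i = 0) \<and> (\<exists>w\<in>grassmannian_C n. core_action n w {} = c \<and>
        (\<forall>k. Lambda0_C k - w Lambda0_C k = (\<Sum>i\<le>n. a' i * simple_root_C n i k)))"
    then obtain w where "w \<in> grassmannian_C n" "core_action n w {} = c"
      "\<And>k. Lambda0_C k - w Lambda0_C k = (\<Sum>i\<le>n. a' i * simple_root_C n i k)" by blast
    then have "(\<Sum>i\<le>n. (a' i - a i) * simple_root_C n i k) = 0" for k
      using expansion by (simp add: left_diff_distrib sum_subtractf)
    then have "a' i - a i = 0" if "i \<le> n" for i
      using simple_root_C_independent[OF n, of "\<lambda>i. a' i - a i"] that by blast
    then show "a' = a"
      using a' by (metis a_def eq_iff_diff_eq_0 ext not_le)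
  qed
  then show ?thesis using \<open>i \<le> n\<close> by (simp add: a_def)
qed

theorem proposition5p4:
  fixes n :: nat and c :: "(nat \<times> nat) set"
  assumes "n \<ge> 2" and "c \<in> self_conjugate_cores (2 * n)"
  shows "atomic_length_C n c = real (num_boxes c)"
proof -
  have fin: "finite c"
    using assms(2) by (auto simp: self_conjugate_cores_def cores_def is_partition_finite)
  have "atomic_length_C n c = real (\<Sum>i\<le>n. card {b \<in> c. folded_residue n b = i})"
    using coeff_C_self_conjugate[OF assms] by (simp add: atomic_length_C_def)
  also have "(\<Sum>i\<le>n. card {b \<in> c. folded_residue n b = i}) = card c"
    using sum.group[OF fin finite_atMost, of "folded_residue n" n "\<lambda>_. 1 :: nat"]
    by (simp add: image_subset_iff folded_residue_le)
  finally show ?thesis by (simp add: num_boxes_def)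
qed

end
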